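(* Let $\Gamma$ be a Coxeter graph with finite vertex set $S$, and let $T$ be a subset of $S$. If $\Gamma$ is of type $K(\pi,1)$, then $\Gamma_T$ is also of type $K(\pi,1)$.
   Context: A Coxeter matrix over a finite set $S$ is a matrix $(m_{s,t})_{s,t\in S}$ with $m_{s,s}=1$ and $m_{s,t}=m_{t,s}\in\{2,3,\dots,\infty\}$ for $s\ne t$; its Coxeter graph $\Gamma$ has vertex set $S$, with an edge between $s,t$ if $m_{s,t}\ge 3$, labeled by $m_{s,t}$ if $m_{s,t}\ge4$. Its Coxeter group is $W=\langle S\mid s^2=1,\ (st)^{m_{s,t}}=1\ (s\neq t,\ m_{s,t}\ne\infty)\rangle$. For $T\subset S$, $\Gamma_T$ is the Coxeter graph of $(m_{s,t})_{s,t\in T}$. The group $W$ acts faithfully, via the canonical representation, on a real vector space $V$ of dimension $|S|$: explicitly, $V$ is the dual of $\bigoplus_{s\in S}\mathbb R e_s$, on which $s\in S$ acts by $x\mapsto x-2B(x,e_s)e_s$ with $B(e_s,e_t)=-\cos(\pi/m_{s,t})$ (and $-1$ if $m_{s,t}=\infty$), and $W$ acts on $V$ by the contragredient action. The Tits cone $I$, understood as a convex open cone, is the interior of $\bigcup_{w\in W}w\{f\in V: f(e_s)\ge 0\ \forall s\in S\}$. The set of reflections is $R=\{wsw^{-1}: s\in S, w\in W\}$, and $H_r\subset V$ is the hyperplane fixed by $r\in R$. Set $$E_\Gamma=(I\times V)\setminus\bigcup_{r\in R}(H_r\times H_r).$$ $\Gamma$ is said to be of type $K(\pi,1)$ if $E_\Gamma$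 is an Eilenberg–MacLane space $K(\pi_1(E_\Gamma),1)$ (i.e. is aspherical). *)

theory Defs
  imports "HOL-Analysis.Analysis" "HOL-Algebra.Group" "HOL-Library.Extended_Nat"
begin

section \<open>Groups given by generators and relators\<close>

text \<open>A word is a list of signed letters; \<open>(x, True)\<close> stands for the generator \<open>x\<close> and
  \<open>(x, False)\<close> for its formal inverse.\<close>

type_synonym 'a word = "('a \<times> bool) list"

definition words :: "'a set \<Rightarrow> 'a word set" where
  "words X = lists (X \<times> UNIV)"

inductive pres_eq :: "'a set \<Rightarrow> 'a word set \<Rightarrow> 'a word \<Rightarrow> 'a word \<Rightarrow> bool"
  for X :: "'a set" and Rel :: "'a word set" where
  pres_refl: "w \<in> words X \<Longrightarrow> pres_eq X Rel w w"
| pres_sym: "pres_eq X Rel v w \<Longrightarrow> pres_eq X Rel w v"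
| pres_trans: "pres_eq X Rel u v \<Longrightarrow> pres_eq X Rel v w \<Longrightarrow> pres_eq X Rel u w"
| pres_cancel: "u \<in> words X \<Longrightarrow> v \<in> words X \<Longrightarrow> x \<in> X
    \<Longrightarrow> pres_eq X Rel (u @ [(x, b), (x, \<not> b)] @ v) (u @ v)"
| pres_relator: "u \<in> words X \<Longrightarrow> v \<in> words X \<Longrightarrow> r \<in> words X \<Longrightarrow> r \<in> Rel
    \<Longrightarrow> pres_eq X Rel (u @ r @ v) (u @ v)"

definition pres_rel :: "'a set \<Rightarrow> 'a word set \<Rightarrow> ('a word \<times> 'a word) set" where
  "pres_rel X Rel = {(v, w). pres_eq X Rel v w}"

definition presented_group :: "'a set \<Rightarrow> 'a word set \<Rightarrow> 'a word set monoid" where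
  "presented_group X Rel =
     \<lparr> carrier = words X // pres_rel X Rel,
       mult = (\<lambda>A B. \<Union>a\<in>A. \<Union>b\<in>B. pres_rel X Rel `` {a @ b}),
       one = pres_rel X Rel `` {[]} \<rparr>"


section \<open>Coxeter matrices and Coxeter groups\<close>

text \<open>A Coxeter graph \<open>\<Gamma>\<close> and its Coxeter matrix determine each other, so \<open>\<Gamma>\<close> is represented by the
  pair \<open>S\<close>, \<open>m\<close>. All notions below use \<open>m\<close> on \<open>S \<times> S\<close> only; hence \<open>\<Gamma>\<^sub>T\<close> is
  represented by \<open>T\<close>, \<open>m\<close>.\<close>

definition coxeter_matrix :: "'a set \<Rightarrow> ('a \<Rightarrow> 'a \<Rightarrow> enat) \<Rightarrow> bool" where
  "coxeter_matrix S m \<longleftrightarrow> finite S \<and> (\<forall>s\<in>S. m s s = 1) \<and>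
     (\<forall>s\<in>S. \<forall>t\<in>S. s \<noteq> t \<longrightarrow> m s t = m t s \<and> 2 \<le> m s t)"

definition coxeter_relators :: "'a set \<Rightarrow> ('a \<Rightarrow> 'a \<Rightarrow> enat) \<Rightarrow> 'a word set" where
  "coxeter_relators S m =
     {[(s, True), (s, True)] | s. s \<in> S} \<union>
     {concat (replicate k [(s, True), (t, True)]) | s t k. s \<in> S \<and> t \<in> S \<and> s \<noteq> t \<and> m s t = enat k}"

definition coxeter_group :: "'a set \<Rightarrow> ('a \<Rightarrow> 'a \<Rightarrow> enat) \<Rightarrow> 'a word set monoid" where
  "coxeter_group S m = presented_group S (coxeter_relators S m)"

definition generator :: "'a set \<Rightarrow> ('a \<Rightarrow> 'a \<Rightarrow> enat) \<Rightarrow> 'a \<Rightarrow> 'a word set" where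
  "generator S m s = pres_rel S (coxeter_relators S m) `` {[(s, True)]}"

definition reflections :: "'a set \<Rightarrow> ('a \<Rightarrow> 'a \<Rightarrow> enat) \<Rightarrow> 'a word set set" where
  "reflections S m =
     {w \<otimes>\<^bsub>coxeter_group S m\<^esub> generator S m s \<otimes>\<^bsub>coxeter_group S m\<^esub> inv\<^bsub>coxeter_group S m\<^esub> w
       | s w. s \<in> S \<and> w \<in> carrier (coxeter_group S m)}"


section \<open>The canonical representation and its dual\<close>

text \<open>A vector \<open>x\<close> of the direct sum of the lines spanned by the \<open>e\<^sub>s\<close> is the extensional
  function \<open>S \<rightarrow> \<real>\<close> of its coordinates.  An element \<open>f\<close> of the dual space \<open>V\<close> is the
  extensional function \<open>s \<mapsto> f(e\<^sub>s)\<close>, and \<open>f(x)\<close> is \<^term>\<open>\<Sum>s\<in>S. f s * x s\<close>.  The topology of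
  the finite-dimensional space \<open>V\<close> is the product topology \<^term>\<open>powertop_real S\<close>.\<close>

definition basis_vec :: "'a set \<Rightarrow> 'a \<Rightarrow> 'a \<Rightarrow> real" where
  "basis_vec S s = (\<lambda>t\<in>S. if t = s then 1 else 0)"

definition gram :: "('a \<Rightarrow> 'a \<Rightarrow> enat) \<Rightarrow> 'a \<Rightarrow> 'a \<Rightarrow> real" where
  "gram m s t = (case m s t of enat k \<Rightarrow> - cos (pi / real k) | \<infinity> \<Rightarrow> - 1)"

definition bform :: "'a set \<Rightarrow> ('a \<Rightarrow> 'a \<Rightarrow> enat) \<Rightarrow> ('a \<Rightarrow> real) \<Rightarrow> ('a \<Rightarrow> real) \<Rightarrow> real" where
  "bform S m x y = (\<Sum>s\<in>S. \<Sum>t\<in>S. x s * y t * gram m s t)"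

definition simple_refl :: "'a set \<Rightarrow> ('a \<Rightarrow> 'a \<Rightarrow> enat) \<Rightarrow> 'a \<Rightarrow> ('a \<Rightarrow> real) \<Rightarrow> 'a \<Rightarrow> real" where
  "simple_refl S m s x = (\<lambda>t\<in>S. x t - 2 * bform S m x (basis_vec S s) * basis_vec S s t)"

text \<open>The sign of a letter is irrelevant here, because \<^const>\<open>simple_refl\<close> is an involution.\<close>

definition word_act :: "'a set \<Rightarrow> ('a \<Rightarrow> 'a \<Rightarrow> enat) \<Rightarrow> 'a word \<Rightarrow> ('a \<Rightarrow> real) \<Rightarrow> 'a \<Rightarrow> real" where
  "word_act S m w x = foldr (\<lambda>(s, b). simple_refl S m s) w x"

text \<open>A group element acts through any word representing it; see \<open>canon_act_class\<close> below for
  independence of the choice.\<close>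

definition canon_act :: "'a set \<Rightarrow> ('a \<Rightarrow> 'a \<Rightarrow> enat) \<Rightarrow> 'a word set \<Rightarrow> ('a \<Rightarrow> real) \<Rightarrow> 'a \<Rightarrow> real" where
  "canon_act S m g = word_act S m (SOME w. w \<in> g)"

definition pairing :: "'a set \<Rightarrow> ('a \<Rightarrow> real) \<Rightarrow> ('a \<Rightarrow> real) \<Rightarrow> real" where
  "pairing S f x = (\<Sum>s\<in>S. f s * x s)"

text \<open>The contragredient action \<open>(g f)(x) = f(g\<^sup>-\<^sup>1 x)\<close>, evaluated at the basis vectors.\<close>

definition dual_act :: "'a set \<Rightarrow> ('a \<Rightarrow> 'a \<Rightarrow> enat) \<Rightarrow> 'a word set \<Rightarrow> ('a \<Rightarrow> real) \<Rightarrow> 'a \<Rightarrow> real" where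
  "dual_act S m g f =
     (\<lambda>t\<in>S. pairing S f (canon_act S m (inv\<^bsub>coxeter_group S m\<^esub> g) (basis_vec S t)))"


section \<open>The Tits cone and the complement of the reflection arrangement\<close>

definition dual_chamber :: "'a set \<Rightarrow> ('a \<Rightarrow> real) set" where
  "dual_chamber S = {f \<in> topspace (powertop_real S). \<forall>s\<in>S. 0 \<le> f s}"

definition tits_cone :: "'a set \<Rightarrow> ('a \<Rightarrow> 'a \<Rightarrow> enat) \<Rightarrow> ('a \<Rightarrow> real) set" where
  "tits_cone S m = powertop_real S interior_of
     (\<Union>w\<in>carrier (coxeter_group S m). dual_act S m w ` dual_chamber S)"

definition hyperplane :: "'a set \<Rightarrow> ('a \<Rightarrow> 'a \<Rightarrow> enat) \<Rightarrow> 'a word set \<Rightarrow> ('a \<Rightarrow> real) set" where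
  "hyperplane S m r = {f \<in> topspace (powertop_real S). dual_act S m r f = f}"

definition arrangement_complement ::
    "'a set \<Rightarrow> ('a \<Rightarrow> 'a \<Rightarrow> enat) \<Rightarrow> (('a \<Rightarrow> real) \<times> ('a \<Rightarrow> real)) topology" where
  "arrangement_complement S m =
     subtopology (prod_topology (powertop_real S) (powertop_real S))
       (tits_cone S m \<times> topspace (powertop_real S)
         - (\<Union>r\<in>reflections S m. hyperplane S m r \<times> hyperplane S m r))"


section \<open>Aspherical spaces and the type of a Coxeter graph\<close>

definition sphere_base :: "nat \<Rightarrow> real" where
  "sphere_base = (\<lambda>i. if i = 0 then 1 else 0)"

definition pointed_maps :: "nat \<Rightarrow> 'b topology \<Rightarrow> 'b \<Rightarrow> ((nat \<Rightarrow> real) \<Rightarrow> 'b) set" where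
  "pointed_maps n X a = {f. continuous_map (nsphere n) X f \<and> f sphere_base = a}"

text \<open>The underlying set of the homotopy group \<open>\<pi>\<^sub>n(X, a)\<close>: pointed homotopy classes of
  pointed maps from the \<open>n\<close>-sphere.\<close>

definition homotopy_classes :: "nat \<Rightarrow> 'b topology \<Rightarrow> 'b \<Rightarrow> ((nat \<Rightarrow> real) \<Rightarrow> 'b) set set" where
  "homotopy_classes n X a = pointed_maps n X a //
     {(f, g). homotopic_with (\<lambda>h. h sphere_base = a) (nsphere n) X f g}"

text \<open>\<open>X\<close> is a \<open>K(\<pi>\<^sub>1(X), 1)\<close>: connected, with trivial homotopy groups in degrees at least 2.\<close>

definition aspherical :: "'b topology \<Rightarrow> bool" where
  "aspherical X \<longleftrightarrow> topspace X \<noteq> {} \<and> path_connected_space X \<and>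
     (\<forall>n\<ge>2. \<forall>a\<in>topspace X. is_singleton (homotopy_classes n X a))"

definition type_K_pi_1 :: "'a set \<Rightarrow> ('a \<Rightarrow> 'a \<Rightarrow> enat) \<Rightarrow> bool" where
  "type_K_pi_1 S m \<longleftrightarrow> aspherical (arrangement_complement S m)"


section \<open>Well-definedness\<close>

lemma words_append [simp]: "u @ v \<in> words X \<longleftrightarrow> u \<in> words X \<and> v \<in> words X"
  by (simp add: words_def)

lemma words_Nil [simp]: "[] \<in> words X"
  by (simp add: words_def)

lemma pres_eq_words: "pres_eq X Rel v w \<Longrightarrow> v \<in> words X \<and> w \<in> words X"
  by (induction rule: pres_eq.induct) (auto simp: words_def)

lemma equiv_pres_rel: "equiv (words X) (pres_rel X Rel)"
proof (rule equivI)
  show "pres_rel X Rel \<subseteq> words X \<times> words X"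
    using pres_eq_words by (fastforce simp: pres_rel_def)
  show "refl_on (words X) (pres_rel X Rel)"
    by (rule refl_onI) (simp add: pres_rel_def pres_refl)
  show "sym (pres_rel X Rel)"
    by (rule symI) (simp add: pres_rel_def pres_sym)
  show "trans (pres_rel X Rel)"
    by (rule transI) (auto simp: pres_rel_def elim: pres_trans)
qed

lemma pres_eq_context:
  assumes "pres_eq X Rel v w" "a \<in> words X" "b \<in> words X"
  shows "pres_eq X Rel (a @ v @ b) (a @ w @ b)"
  using assms
proof (induction rule: pres_eq.induct)
  case (pres_cancel u v x c)
  then show ?case using pres_eq.pres_cancel[of "a @ u" X "v @ b" x Rel c] by simp
next
  case (pres_relator u v r)
  then show ?case using pres_eq.pres_relator[of "a @ u" X "v @ b" r Rel] by simp
qed (auto intro: pres_eq.intros)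

lemma pres_eq_append:
  assumes "pres_eq X Rel v v'" "pres_eq X Rel w w'"
  shows "pres_eq X Rel (v @ w) (v' @ w')"
proof (rule pres_trans)
  have "v' \<in> words X" "w \<in> words X"
    using assms pres_eq_words by blast+
  then show "pres_eq X Rel (v @ w) (v' @ w)" "pres_eq X Rel (v' @ w) (v' @ w')"
    using pres_eq_context[OF assms(1), of "[]" w] pres_eq_context[OF assms(2), of v' "[]"]
    by simp_all
qed

lemma presented_group_mult:
  assumes "v \<in> words X" "w \<in> words X"
  shows "(pres_rel X Rel `` {v}) \<otimes>\<^bsub>presented_group X Rel\<^esub> (pres_rel X Rel `` {w})
           = pres_rel X Rel `` {v @ w}"
proof -
  have "pres_rel X Rel `` {a @ b} = pres_rel X Rel `` {v @ w}"
    if "a \<in> pres_rel X Rel `` {v}" "b \<in> pres_rel X Rel `` {w}" for a b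
  proof -
    have "(v @ w, a @ b) \<in> pres_rel X Rel"
      using that by (simp add: pres_rel_def pres_eq_append)
    then show ?thesis by (rule equiv_class_eq[OF equiv_pres_rel, symmetric])
  qed
  then have *: "(\<Union>b\<in>pres_rel X Rel `` {w}. pres_rel X Rel `` {a @ b})
      = (\<Union>b\<in>pres_rel X Rel `` {w}. pres_rel X Rel `` {v @ w})"
    if "a \<in> pres_rel X Rel `` {v}" for a
    using that by (intro SUP_cong refl)
  have "v \<in> pres_rel X Rel `` {v}" "w \<in> pres_rel X Rel `` {w}"
    using assms by (simp_all add: pres_rel_def pres_refl)
  then have ne: "pres_rel X Rel `` {v} \<noteq> {}" "pres_rel X Rel `` {w} \<noteq> {}"
    by (metis empty_iff)+
  have "(\<Union>a\<in>pres_rel X Rel `` {v}. \<Union>b\<in>pres_rel X Rel `` {w}. pres_rel X Rel `` {a @ b})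
      = (\<Union>a\<in>pres_rel X Rel `` {v}. \<Union>b\<in>pres_rel X Rel `` {w}. pres_rel X Rel `` {v @ w})"
    by (intro SUP_cong refl *)
  also have "\<dots> = pres_rel X Rel `` {v @ w}"
    by (simp only: UN_constant ne if_False)
  finally show ?thesis
    by (simp only: presented_group_def monoid.simps)
qed

definition formal_inverse :: "'a word \<Rightarrow> 'a word" where
  "formal_inverse w = rev (map (\<lambda>(x, b). (x, \<not> b)) w)"

lemma formal_inverse_words: "w \<in> words X \<Longrightarrow> formal_inverse w \<in> words X"
  by (auto simp: formal_inverse_def words_def)

lemma pres_eq_formal_inverse:
  "w \<in> words X \<Longrightarrow> pres_eq X Rel (formal_inverse w @ w) []"
proof (induction w)
  case Nil
  then show ?case by (simp add: formal_inverse_def pres_refl)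
next
  case (Cons a w)
  obtain x b where a: "a = (x, b)" by force
  have w: "w \<in> words X" "x \<in> X" using Cons.prems by (auto simp: words_def a)
  have "pres_eq X Rel (formal_inverse w @ [(x, \<not> b), (x, \<not> \<not> b)] @ w) (formal_inverse w @ w)"
    using w by (intro pres_cancel formal_inverse_words)
  then show ?case
    using pres_trans[OF _ Cons.IH[OF w(1)]] by (simp add: a formal_inverse_def)
qed

lemma presented_group_carrierE:
  assumes "g \<in> carrier (presented_group X Rel)"
  obtains w where "w \<in> words X" "g = pres_rel X Rel `` {w}"
  using assms by (auto simp: presented_group_def quotient_def)

lemma presented_group_class:
  "w \<in> words X \<Longrightarrow> pres_rel X Rel `` {w} \<in> carrier (presented_group X Rel)"
  by (auto simp: presented_group_def quotient_def)

lemma presented_group_one: "\<one>\<^bsub>presented_group X Rel\<^esub> = pres_rel X Rel `` {[]}"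
  by (simp add: presented_group_def)

theorem group_presented_group: "group (presented_group X Rel)"
proof -
  let ?G = "presented_group X Rel" and ?c = "\<lambda>w. pres_rel X Rel `` {w}"
  have mult: "?c v \<otimes>\<^bsub>?G\<^esub> ?c w = ?c (v @ w)" if "v \<in> words X" "w \<in> words X" for v w
    using that by (rule presented_group_mult)
  have rep: "\<exists>w\<in>words X. g = ?c w" if "g \<in> carrier ?G" for g
    using that by (meson presented_group_carrierE)
  show ?thesis
  proof (rule groupI)
    fix g h assume "g \<in> carrier ?G" "h \<in> carrier ?G"
    then obtain v w where "v \<in> words X" "w \<in> words X" and gh: "g = ?c v" "h = ?c w"
      using rep by metis
    then show "g \<otimes>\<^bsub>?G\<^esub> h \<in> carrier ?G"
      unfolding gh by (subst mult) (auto intro: presented_group_class)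
  next
    show "\<one>\<^bsub>?G\<^esub> \<in> carrier ?G"
      unfolding presented_group_one by (rule presented_group_class) simp
  next
    fix g h k assume "g \<in> carrier ?G" "h \<in> carrier ?G" "k \<in> carrier ?G"
    then obtain u v w where w: "u \<in> words X" "v \<in> words X" "w \<in> words X"
      and ghk: "g = ?c u" "h = ?c v" "k = ?c w"
      using rep by metis
    have "u @ v \<in> words X" "v @ w \<in> words X" using w by simp_all
    then show "g \<otimes>\<^bsub>?G\<^esub> h \<otimes>\<^bsub>?G\<^esub> k = g \<otimes>\<^bsub>?G\<^esub> (h \<otimes>\<^bsub>?G\<^esub> k)"
      unfolding ghk using w by (simp only: mult append_assoc)
  next
    fix g assume "g \<in> carrier ?G"
    then obtain w where w: "w \<in> words X" and g: "g = ?c w"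
      using rep by metis
    show "\<one>\<^bsub>?G\<^esub> \<otimes>\<^bsub>?G\<^esub> g = g"
      unfolding g presented_group_one using w by (simp only: mult words_Nil append_Nil)
    have "?c (formal_inverse w @ w) = ?c []"
      by (intro equiv_class_eq[OF equiv_pres_rel])
        (simp add: pres_rel_def pres_eq_formal_inverse[OF w])
    then have "?c (formal_inverse w) \<otimes>\<^bsub>?G\<^esub> g = \<one>\<^bsub>?G\<^esub>"
      unfolding g presented_group_one using w formal_inverse_words[OF w] by (simp only: mult)
    then show "\<exists>h\<in>carrier ?G. h \<otimes>\<^bsub>?G\<^esub> g = \<one>\<^bsub>?G\<^esub>"
      using presented_group_class[OF formal_inverse_words[OF w]] by (rule bexI)
  qed
qed

corollary group_coxeter_group: "group (coxeter_group S m)"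
  by (simp add: coxeter_group_def group_presented_group)

lemma bform_basis:
  assumes "finite S" "t \<in> S"
  shows "bform S m x (basis_vec S t) = (\<Sum>s\<in>S. x s * gram m s t)"
proof -
  have "(\<Sum>u\<in>S. x s * basis_vec S t u * gram m s u) = x s * gram m s t" for s
  proof -
    have "(\<Sum>u\<in>S. x s * basis_vec S t u * gram m s u) = (\<Sum>u\<in>S. if u = t then x s * gram m s u else 0)"
      by (rule sum.cong) (auto simp: basis_vec_def)
    then show ?thesis using assms by simp
  qed
  then show ?thesis by (simp add: bform_def)
qed

lemma bform_basis_add:
  assumes "finite S" "s \<in> S" "t \<in> S"
  shows "bform S m (\<lambda>u\<in>S. x u + a * basis_vec S s u) (basis_vec S t)
           = bform S m x (basis_vec S t) + a * gram m s t"
proof -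
  have "(\<Sum>u\<in>S. (\<lambda>u\<in>S. x u + a * basis_vec S s u) u * gram m u t)
      = (\<Sum>u\<in>S. x u * gram m u t + (if u = s then a * gram m u t else 0))"
    by (rule sum.cong) (auto simp: basis_vec_def algebra_simps)
  then show ?thesis using assms by (simp add: bform_basis sum.distrib)
qed

lemma bform_simple_refl:
  assumes "finite S" "s \<in> S" "t \<in> S"
  shows "bform S m (simple_refl S m s x) (basis_vec S t)
           = bform S m x (basis_vec S t) - 2 * bform S m x (basis_vec S s) * gram m s t"
  using bform_basis_add[OF assms, of m x "- 2 * bform S m x (basis_vec S s)"]
  by (simp add: simple_refl_def)

lemma simple_refl_extensional: "simple_refl S m s x \<in> extensional S"
  by (simp add: simple_refl_def)

lemma word_act_extensional: "x \<in> extensional S \<Longrightarrow> word_act S m w x \<in> extensional S"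
  by (cases w) (simp_all add: word_act_def simple_refl_extensional case_prod_beta)

lemma word_act_append: "word_act S m (v @ w) x = word_act S m v (word_act S m w x)"
  by (simp add: word_act_def)

lemma gram_self:
  assumes "coxeter_matrix S m" "s \<in> S"
  shows "gram m s s = 1"
proof -
  have "m s s = enat 1"
    using assms unfolding coxeter_matrix_def one_enat_def by blast
  then show ?thesis by (simp add: gram_def)
qed

lemma simple_refl_involution:
  assumes "coxeter_matrix S m" "s \<in> S" "x \<in> extensional S"
  shows "simple_refl S m s (simple_refl S m s x) = x"
proof -
  have fin: "finite S" using assms(1) by (simp add: coxeter_matrix_def)
  have "bform S m (simple_refl S m s x) (basis_vec S s) = - bform S m x (basis_vec S s)"
    using bform_simple_refl[OF fin assms(2,2), of m x] gram_self[OF assms(1,2)] by simp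
  then have "simple_refl S m s (simple_refl S m s x) u = x u" if "u \<in> S" for u
    using that by (simp add: simple_refl_def[of S m s "simple_refl S m s x"])
      (simp add: simple_refl_def)
  moreover have "simple_refl S m s (simple_refl S m s x) u = x u" if "u \<notin> S" for u
    using that assms(3) simple_refl_extensional by (metis extensional_arb)
  ultimately show ?thesis by blast
qed

text \<open>The dihedral relation: in the coordinates \<open>P + i Q\<close> of the plane spanned by \<open>e\<^sub>s\<close> and \<open>e\<^sub>t\<close>,
  the product of the two reflections is multiplication by a root of unity of order dividing \<open>k\<close>.\<close>

lemma word_act_dihedral:
  assumes "coxeter_matrix S m" "s \<in> S" "t \<in> S" "s \<noteq> t" "m s t = enat k" "x \<in> extensional S"
  shows "word_act S m (concat (replicate k [(s, True), (t, True)])) x = x"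
proof -
  have fin: "finite S"
    using assms(1) unfolding coxeter_matrix_def by (rule conjunct1)
  have "\<forall>s\<in>S. \<forall>t\<in>S. s \<noteq> t \<longrightarrow> m s t = m t s \<and> 2 \<le> m s t"
    using assms(1) unfolding coxeter_matrix_def by (elim conjE)
  note st = this[rule_format, OF assms(2-4)]
  have mts: "m t s = enat k"
    by (rule trans[OF sym[OF conjunct1[OF st]] assms(5)])
  have "2 \<le> enat k"
    using conjunct2[OF st] unfolding assms(5) .
  then have k2: "2 \<le> k"
    by (simp only: numeral_eq_enat enat_ord_simps)
  define \<theta> where "\<theta> = pi / real k"
  define c where "c = cos \<theta>"
  define d where "d = sin \<theta>"
  have "0 < \<theta>" using k2 by (simp add: \<theta>_def)
  moreover have "\<theta> < pi" using k2 pi_gt_zero unfolding \<theta>_def by (simp add: divide_less_eq)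
  ultimately have "0 < d" unfolding d_def by (rule sin_gt_zero)
  then have d: "d \<noteq> 0" by simp
  have cd: "c * c + d * d = 1"
    using sin_cos_squared_add2[of \<theta>] by (simp add: c_def d_def power2_eq_square)
  have g: "gram m s t = - c" "gram m t s = - c" "gram m s s = 1" "gram m t t = 1"
    using gram_self[OF assms(1)] assms(2,3,5) mts by (simp_all add: gram_def c_def \<theta>_def)
  define p where "p y = bform S m y (basis_vec S s)" for y
  define q where "q y = bform S m y (basis_vec S t)" for y
  define z where "z y = Complex (p y) ((q y + c * p y) / d)" for y
  define f where "f y = simple_refl S m s (simple_refl S m t y)" for y
  have pt: "p (simple_refl S m t y) = p y + 2 * c * q y"
    and qt: "q (simple_refl S m t y) = - q y"
    and ps: "p (simple_refl S m s y) = - p y"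
    and qs: "q (simple_refl S m s y) = q y + 2 * c * p y" for y
    using assms(2,3) fin by (simp_all add: p_def q_def bform_simple_refl g)
  have f_eq: "f y = (\<lambda>u\<in>S. y u - 2 * q y * basis_vec S t u
      - 2 * p (simple_refl S m t y) * basis_vec S s u)" for y
    unfolding f_def p_def q_def simple_refl_def by (simp add: restrict_def fun_eq_iff)
  have z_f: "z (f y) = cis (2 * \<theta>) * z y" for y
  proof -
    have cos2: "cos (2 * \<theta>) = 2 * c * c - 1" and sin2: "sin (2 * \<theta>) = 2 * c * d"
      by (simp_all add: cos_double_cos sin_double c_def d_def power2_eq_square)
    have dd: "d * d = 1 - c * c" using cd by simp
    have pf: "p (f y) = - p y - 2 * c * q y"
      and qf: "q (f y) = - q y + 2 * c * (p y + 2 * c * q y)"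
      by (simp_all add: f_def ps qs pt qt)
    define Q where "Q = (q y + c * p y) / d"
    have dQ: "q y + c * p y = d * Q" using d by (simp add: Q_def)
    have "p (f y) = (2 * c * c - 1) * p y - 2 * c * (q y + c * p y)"
      by (simp add: pf algebra_simps)
    then have 1: "p (f y) = (2 * c * c - 1) * p y - 2 * c * d * Q"
      by (simp add: dQ)
    have "q (f y) + c * p (f y) = (2 * c * c - 1) * (q y + c * p y) + 2 * c * (1 - c * c) * p y"
      by (simp add: pf qf algebra_simps)
    also have "\<dots> = (2 * c * c - 1) * (d * Q) + 2 * c * (d * d) * p y"
      by (simp only: dd dQ)
    also have "\<dots> = d * ((2 * c * c - 1) * Q + 2 * c * d * p y)"
      by (simp add: algebra_simps)
    finally have "(q (f y) + c * p (f y)) / d = (2 * c * c - 1) * Q + 2 * c * d * p y"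
      using d by simp
    then have "z (f y) = Complex ((2 * c * c - 1) * p y - 2 * c * d * Q)
        ((2 * c * c - 1) * Q + 2 * c * d * p y)"
      by (simp add: z_def 1)
    moreover have "z y = Complex (p y) Q" by (simp add: z_def Q_def)
    ultimately show ?thesis
      by (simp add: complex_eq_iff cos2 sin2)
  qed
  have z_fn: "z ((f ^^ n) x) = cis (2 * \<theta>) ^ n * z x" for n
    by (induction n) (simp_all add: z_f)
  have "real k * (2 * \<theta>) = 2 * pi"
    using k2 by (simp add: \<theta>_def)
  then have "cis (2 * \<theta>) ^ k = 1"
    by (simp only: Complex.DeMoivre cis_2pi)
  then have "z ((f ^^ k) x) = z x"
    by (simp add: z_fn)
  then have pk: "p ((f ^^ k) x) = p x" and qk: "q ((f ^^ k) x) = q x"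
    using d by (auto simp: z_def)
  have "\<exists>a b. (f ^^ n) x = (\<lambda>u\<in>S. (\<lambda>u\<in>S. x u + a * basis_vec S s u) u + b * basis_vec S t u)" for n
  proof (induction n)
    case 0
    show ?case
      using assms(6) by (intro exI[of _ 0]) (auto simp: fun_eq_iff extensional_def)
  next
    case (Suc n)
    then obtain a b where
      ab: "(f ^^ n) x = (\<lambda>u\<in>S. (\<lambda>u\<in>S. x u + a * basis_vec S s u) u + b * basis_vec S t u)"
      by blast
    have "(f ^^ Suc n) x = (\<lambda>u\<in>S. (\<lambda>u\<in>S. x u + (a - 2 * p (simple_refl S m t ((f ^^ n) x))) * basis_vec S s u) u
        + (b - 2 * q ((f ^^ n) x)) * basis_vec S t u)"
    proof
      fix u
      show "(f ^^ Suc n) x u = (\<lambda>u\<in>S. (\<lambda>u\<in>S. x u + (a - 2 * p (simple_refl S m t ((f ^^ n) x))) * basis_vec S s u) u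
        + (b - 2 * q ((f ^^ n) x)) * basis_vec S t u) u"
        using fun_cong[OF ab, of u]
        by (cases "u \<in> S") (simp_all add: f_eq left_diff_distrib)
    qed
    then show ?case by blast
  qed
  then obtain a b where
    ab: "(f ^^ k) x = (\<lambda>u\<in>S. (\<lambda>u\<in>S. x u + a * basis_vec S s u) u + b * basis_vec S t u)"
    by blast
  have "p ((f ^^ k) x) = p x + a - b * c" "q ((f ^^ k) x) = q x - a * c + b"
    unfolding ab p_def q_def bform_basis_add[OF fin assms(2,2)] bform_basis_add[OF fin assms(2,3)]
      bform_basis_add[OF fin assms(3,2)] bform_basis_add[OF fin assms(3,3)] g
    by simp_all
  then have a: "a = b * c" and "b = a * c" using pk qk by auto
  then have "b = b * (c * c)" by (metis mult.assoc)
  moreover have "b = b * (c * c) + b * (d * d)" using cd by (metis distrib_left mult_1_right)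
  ultimately have "b * (d * d) = 0" by linarith
  then have b: "b = 0" using d by simp
  with a have "a = 0" by simp
  with b have "(f ^^ k) x = x"
    using assms(6) by (auto simp: ab fun_eq_iff extensional_def)
  moreover have "word_act S m (concat (replicate n [(s, True), (t, True)])) x = (f ^^ n) x" for n
    by (induction n) (simp_all add: word_act_def f_def)
  ultimately show ?thesis by simp
qed

lemma word_act_cong:
  assumes "coxeter_matrix S m" "pres_eq S (coxeter_relators S m) v w" "x \<in> extensional S"
  shows "word_act S m v x = word_act S m w x"
  using assms(2,3)
proof (induction arbitrary: x rule: pres_eq.induct)
  case (pres_cancel u v y b)
  then show ?case
    using simple_refl_involution[OF assms(1) \<open>y \<in> S\<close> word_act_extensional]
    by (simp only: word_act_append) (simp add: word_act_def)
next
  case (pres_relator u v r)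
  have "word_act S m r y = y" if y: "y \<in> extensional S" for y
    using \<open>r \<in> coxeter_relators S m\<close> simple_refl_involution[OF assms(1) _ y]
      word_act_dihedral[OF assms(1) _ _ _ _ y]
    by (auto simp: coxeter_relators_def) (simp add: word_act_def)
  then show ?case
    using pres_relator.prems by (simp add: word_act_append word_act_extensional)
qed simp_all

theorem canon_act_class:
  assumes "coxeter_matrix S m" "w \<in> words S" "x \<in> extensional S"
  shows "canon_act S m (pres_rel S (coxeter_relators S m) `` {w}) x = word_act S m w x"
proof -
  let ?A = "pres_rel S (coxeter_relators S m) `` {w}"
  have "w \<in> ?A" using assms(2) by (simp add: pres_rel_def pres_refl)
  then have "(SOME v. v \<in> ?A) \<in> ?A" by (rule someI)
  then have "pres_eq S (coxeter_relators S m) w (SOME v. v \<in> ?A)" by (simp add: pres_rel_def)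
  then show ?thesis
    using word_act_cong[OF assms(1) _ assms(3)] by (simp add: canon_act_def)
qed

corollary canon_act_mult:
  assumes "coxeter_matrix S m" "g \<in> carrier (coxeter_group S m)" "h \<in> carrier (coxeter_group S m)"
    "x \<in> extensional S"
  shows "canon_act S m (g \<otimes>\<^bsub>coxeter_group S m\<^esub> h) x = canon_act S m g (canon_act S m h x)"
proof -
  obtain v w where v: "v \<in> words S" "g = pres_rel S (coxeter_relators S m) `` {v}"
    and w: "w \<in> words S" "h = pres_rel S (coxeter_relators S m) `` {w}"
    using assms(2,3) unfolding coxeter_group_def by (meson presented_group_carrierE)
  show ?thesis
    unfolding v(2) w(2) coxeter_group_def presented_group_mult[OF v(1) w(1)]
    using canon_act_class[OF assms(1)] v(1) w(1) assms(4)
    by (simp add: word_act_append word_act_extensional)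
qed

end

theory Submission
  imports Defs
begin

text \<open>
  Restricting functionals to the span of the \<open>e\<^sub>t\<close>, \<open>t \<in> T\<close>, maps the complement for \<open>S\<close> into the complement for
  \<open>T\<close>. Over a compact subset of the complement for \<open>T\<close> this projection has a section: extend each functional by one
  sufficiently large constant on \<open>S - T\<close>. For a large constant every positive root that is not supported in \<open>T\<close>
  is positive on the extension, so the extension lies in the Tits cone and off all the hyperplanes that do
  not come from \<open>T\<close>. Since spheres are compact, a map from a sphere to the complement for \<open>T\<close> lifts, becomes
  null-homotopic upstairs, and the homotopy is projected down.

  The input from Coxeter theory is that every root is nonnegative or nonpositive, together with the
  decomposition of a group element as \<open>u v\<close> with \<open>u\<close> in the parabolic subgroup and \<open>v\<inverse> e\<^sub>t \<ge> 0\<close> for \<open>t \<in> T\<close>.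
\<close>

section \<open>Roots\<close>

lemma rev_in_lists [simp]: "rev ws \<in> lists A \<longleftrightarrow> ws \<in> lists A"
  by (simp add: in_lists_conv_set)

definition cvec :: "'a \<Rightarrow> 'a \<Rightarrow> real" where
  "cvec s = (\<lambda>t. if t = s then 1 else 0)"

text \<open>Vectors are modelled here by total functions vanishing off \<open>S\<close> instead of extensional ones:
  linear combinations then need no restriction, and vectors over a subset of \<open>S\<close> are vectors over \<open>S\<close>.\<close>

definition refl_op :: "'a set \<Rightarrow> ('a \<Rightarrow> 'a \<Rightarrow> enat) \<Rightarrow> 'a \<Rightarrow> ('a \<Rightarrow> real) \<Rightarrow> 'a \<Rightarrow> real" where
  "refl_op S m s x = x(s := x s - 2 * (\<Sum>u\<in>S. x u * gram m u s))"

definition refl_word :: "'a set \<Rightarrow> ('a \<Rightarrow> 'a \<Rightarrow> enat) \<Rightarrow> 'a list \<Rightarrow> ('a \<Rightarrow> real) \<Rightarrow> 'a \<Rightarrow> real" where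
  "refl_word S m ws = foldr (refl_op S m) ws"

lemma refl_word_Nil [simp]: "refl_word S m [] x = x"
  and refl_word_Cons [simp]: "refl_word S m (s # ws) x = refl_op S m s (refl_word S m ws x)"
  and refl_word_append [simp]: "refl_word S m (vs @ ws) x = refl_word S m vs (refl_word S m ws x)"
  by (simp_all add: refl_word_def)

lemma refl_word_comp: "refl_word S m (vs @ ws) = refl_word S m vs \<circ> refl_word S m ws"
  by (simp add: fun_eq_iff)

lemma refl_op_lin:
  "refl_op S m s (\<lambda>u. p * x u + q * y u) = (\<lambda>u. p * refl_op S m s x u + q * refl_op S m s y u)"
proof -
  have "(\<Sum>u\<in>S. (p * x u + q * y u) * gram m u s)
      = p * (\<Sum>u\<in>S. x u * gram m u s) + q * (\<Sum>u\<in>S. y u * gram m u s)"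
    by (simp add: sum_distrib_left sum.distrib algebra_simps)
  then show ?thesis
    by (auto simp: refl_op_def fun_eq_iff algebra_simps)
qed

lemma refl_word_lin:
  "refl_word S m ws (\<lambda>u. p * x u + q * y u)
     = (\<lambda>u. p * refl_word S m ws x u + q * refl_word S m ws y u)"
  by (induction ws) (simp_all add: refl_op_lin)

lemma refl_word_scale: "refl_word S m ws (\<lambda>u. p * x u) = (\<lambda>u. p * refl_word S m ws x u)"
  using refl_word_lin[of S m ws p x 0 x] by simp

lemma refl_word_sum:
  assumes "finite F"
  shows "refl_word S m ws (\<lambda>u. \<Sum>t\<in>F. c t * y t u) = (\<lambda>u. \<Sum>t\<in>F. c t * refl_word S m ws (y t) u)"
  using assms
proof (induction F)
  case empty
  show ?case using refl_word_scale[of S m ws 0] by simp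
next
  case (insert a F)
  then show ?case
    using refl_word_lin[of S m ws "c a" "y a" 1 "\<lambda>u. \<Sum>t\<in>F. c t * y t u"] by simp
qed

lemma cvec_expansion:
  assumes "finite S" "\<forall>u. u \<notin> S \<longrightarrow> x u = 0"
  shows "x = (\<lambda>u. \<Sum>t\<in>S. x t * cvec t u)"
proof
  fix u
  have "(\<Sum>t\<in>S. x t * cvec t u) = (\<Sum>t\<in>S. if t = u then x t else 0)"
    by (rule sum.cong) (auto simp: cvec_def)
  then show "x u = (\<Sum>t\<in>S. x t * cvec t u)"
    using assms by simp
qed

lemma refl_word_expansion:
  assumes "finite S" "\<forall>u. u \<notin> S \<longrightarrow> x u = 0"
  shows "refl_word R m ws x u = (\<Sum>t\<in>S. x t * refl_word R m ws (cvec t) u)"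
  using refl_word_sum[OF assms(1), of R m ws x cvec] cvec_expansion[OF assms] by metis

lemma pairing_expansion:
  assumes "finite S" "\<forall>u. u \<notin> S \<longrightarrow> x u = 0"
  shows "pairing R f (refl_word Q m ws x) = (\<Sum>t\<in>S. x t * pairing R f (refl_word Q m ws (cvec t)))"
proof -
  have "pairing R f (refl_word Q m ws x)
      = (\<Sum>r\<in>R. \<Sum>t\<in>S. f r * (x t * refl_word Q m ws (cvec t) r))"
    unfolding pairing_def sum_distrib_left[symmetric]
    by (rule sum.cong[OF refl]) (simp only: refl_word_expansion[OF assms, where R = Q and m = m and ws = ws])
  also have "\<dots> = (\<Sum>t\<in>S. \<Sum>r\<in>R. f r * (x t * refl_word Q m ws (cvec t) r))"
    by (rule sum.swap)
  finally show ?thesis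
    by (simp add: pairing_def sum_distrib_left algebra_simps)
qed

lemma refl_op_other: "u \<noteq> s \<Longrightarrow> refl_op S m s x u = x u"
  by (simp add: refl_op_def)

lemma refl_word_other: "u \<notin> set ws \<Longrightarrow> refl_word S m ws x u = x u"
  by (induction ws) (simp_all add: refl_op_other)

text \<open>Letters in \<open>T\<close> keep the vector supported in \<open>T\<close>, so the
  summands over \<open>S - T\<close> in each reflection formula vanish. Hence roots of
  \<open>T\<close> may be computed inside the representation of \<open>S\<close>.\<close>

lemma refl_word_subset:
  assumes "finite S" "T \<subseteq> S" "ws \<in> lists T" "\<forall>u. u \<notin> T \<longrightarrow> x u = 0"
  shows "refl_word T m ws x = refl_word S m ws x"
  using assms(3)
proof (induction ws)
  case (Cons s ws)
  then have IH: "refl_word T m ws x = refl_word S m ws x" by simp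
  have "refl_word S m ws x u = 0" if "u \<notin> T" for u
  proof -
    have "u \<notin> set ws" using Cons.hyps that by (auto simp: in_lists_conv_set)
    then show ?thesis using that assms(4) by (simp add: refl_word_other)
  qed
  then have "(\<Sum>u\<in>T. refl_word S m ws x u * gram m u s) = (\<Sum>u\<in>S. refl_word S m ws x u * gram m u s)"
    using assms(1,2) by (intro sum.mono_neutral_left) auto
  then show ?case by (simp add: IH refl_op_def)
qed simp

lemma refl_op_cvec:
  assumes "finite S" "t \<in> S"
  shows "refl_op S m s (cvec t) = (\<lambda>u. cvec t u - 2 * gram m t s * cvec s u)"
proof -
  have "(\<Sum>u\<in>S. cvec t u * gram m u s) = (\<Sum>u\<in>S. if u = t then gram m u s else 0)"
    by (rule sum.cong) (auto simp: cvec_def)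
  then have "(\<Sum>u\<in>S. cvec t u * gram m u s) = gram m t s"
    using assms by simp
  then show ?thesis by (auto simp: refl_op_def cvec_def)
qed

text \<open>This is the bridge from the extensional action to the total-function one: the sign of a
  letter is forgotten by \<open>map fst\<close>, and each reflection sees only coordinates in
  \<open>S\<close>.\<close>

lemma word_act_refl_word:
  assumes "finite S" "map fst w \<in> lists S"
  shows "word_act S m w (restrict x S) = restrict (refl_word S m (map fst w) x) S"
  using assms(2)
proof (induction w)
  case Nil
  show ?case by (simp add: word_act_def)
next
  case (Cons a w)
  obtain s b where a: "a = (s, b)" by force
  have s: "s \<in> S" and "map fst w \<in> lists S"
    using Cons.prems by (simp_all add: a)
  then have IH: "word_act S m w (restrict x S) = restrict (refl_word S m (map fst w) x) S"
    using Cons.IH by blast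
  define y where "y = refl_word S m (map fst w) x"
  have "word_act S m (a # w) (restrict x S) = simple_refl S m s (restrict y S)"
    using IH by (simp add: word_act_def a y_def)
  also have "\<dots> = restrict (refl_op S m s y) S"
  proof
    fix u
    have "(\<Sum>v\<in>S. restrict y S v * gram m v s) = (\<Sum>v\<in>S. y v * gram m v s)"
      by (rule sum.cong) auto
    then have "bform S m (restrict y S) (basis_vec S s) = (\<Sum>v\<in>S. y v * gram m v s)"
      by (simp add: bform_basis[OF assms(1) s])
    then show "simple_refl S m s (restrict y S) u = restrict (refl_op S m s y) S u"
      by (simp add: simple_refl_def refl_op_def) (simp add: basis_vec_def)
  qed
  finally show ?case by (simp only: a y_def list.map fst_conv refl_word_Cons)
qed

locale coxeter =
  fixes S :: "'a set" and m :: "'a \<Rightarrow> 'a \<Rightarrow> enat"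
  assumes cox: "coxeter_matrix S m"
begin

lemma fin: "finite S"
  using cox by (simp add: coxeter_matrix_def)

lemma cox_sym: "s \<in> S \<Longrightarrow> t \<in> S \<Longrightarrow> m s t = m t s"
  using cox by (metis coxeter_matrix_def)

lemma cox_ge2: "s \<in> S \<Longrightarrow> t \<in> S \<Longrightarrow> s \<noteq> t \<Longrightarrow> 2 \<le> m s t"
  using cox by (simp add: coxeter_matrix_def)

abbreviation "act \<equiv> refl_word S m"

text \<open>As \<open>gram m s s = 1\<close>, a reflection changes the sign of B(x, e_s), so the
  multiples of e_s subtracted by two successive reflections cancel.\<close>

lemma refl_op_invol:
  assumes "s \<in> S"
  shows "refl_op S m s (refl_op S m s x) = x"
proof -
  define b where "b = (\<Sum>u\<in>S. x u * gram m u s)"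
  have "(\<Sum>u\<in>S. refl_op S m s x u * gram m u s)
      = (\<Sum>u\<in>S. x u * gram m u s + (if u = s then - 2 * b * gram m u s else 0))"
    by (rule sum.cong) (auto simp: refl_op_def b_def algebra_simps)
  also have "\<dots> = - b"
    using assms fin gram_self[OF cox assms] by (simp add: sum.distrib b_def)
  finally show ?thesis
    by (simp add: refl_op_def[of S m s "refl_op S m s x"]) (simp add: refl_op_def b_def)
qed

text \<open>Every letter is an involution, so reversal of words plays the role of group inversion
  from here on.\<close>

lemma act_rev: "ws \<in> lists S \<Longrightarrow> act (rev ws) (act ws x) = x"
  by (induction ws arbitrary: x) (simp_all add: refl_op_invol)

lemma act_rev': "ws \<in> lists S \<Longrightarrow> act ws (act (rev ws) x) = x"
  using act_rev[of "rev ws" x] by simp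

lemma act_rev_cong:
  assumes "vs \<in> lists S" "ws \<in> lists S" "act vs = act ws"
  shows "act (rev vs) = act (rev ws)"
  using assms act_rev act_rev' by (metis ext)

lemma refl_op_self: "s \<in> S \<Longrightarrow> refl_op S m s (cvec s) = (\<lambda>u. - cvec s u)"
  using refl_op_cvec[OF fin] gram_self[OF cox] by fastforce

lemma act_neg: "act ws (\<lambda>u. - x u) = (\<lambda>u. - act ws x u)"
  using refl_word_scale[of S m ws "-1" x] by simp

lemma act_dihedral:
  assumes "s \<in> S" "t \<in> S" "s \<noteq> t" "m s t = enat k"
  shows "act (concat (replicate k [s, t])) x = x"
proof
  fix u
  let ?w = "concat (replicate k [(s, True), (t, True)])"
  let ?ws = "concat (replicate k [s, t])"
  have w: "map fst ?w = ?ws"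
    by (simp add: map_concat)
  have S: "?ws \<in> lists S" using assms(1,2) by (induction k) auto
  show "act ?ws x u = x u"
  proof (cases "u \<in> S")
    case True
    have "word_act S m ?w (restrict x S) = restrict x S"
      using word_act_dihedral[OF cox assms] by simp
    then have "restrict (act ?ws x) S = restrict x S"
      using word_act_refl_word[OF fin, of ?w m x] w S by simp
    then show ?thesis using True by (metis restrict_apply')
  next
    case False
    then show ?thesis using S by (intro refl_word_other) auto
  qed
qed

end

section \<open>Alternating words and roots in rank two\<close>

text \<open>The word is fixed by its last letter \<open>t\<close> and built from the right, because
  the rightmost letter acts first and the induction on words peels off last letters.\<close>

fun alternating :: "nat \<Rightarrow> 'a \<Rightarrow> 'a \<Rightarrow> 'a list" where
  "alternating 0 s t = []"
| "alternating (Suc k) s t = alternating k t s @ [t]"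

lemma length_alternating [simp]: "length (alternating k s t) = k"
  by (induction k arbitrary: s t) simp_all

lemma alternating_lists: "s \<in> A \<Longrightarrow> t \<in> A \<Longrightarrow> alternating k s t \<in> lists A"
  by (induction k arbitrary: s t) simp_all

lemma alternating_split: "k \<le> n \<Longrightarrow> s \<in> A \<Longrightarrow> t \<in> A \<Longrightarrow> \<exists>ys\<in>lists A. alternating n s t = ys @ alternating k s t"
proof (induction k arbitrary: n s t)
  case 0
  then show ?case using alternating_lists[of s A t n] by auto
next
  case (Suc k)
  then obtain n' where n: "n = Suc n'" "k \<le> n'" by (cases n) auto
  from Suc.IH[OF n(2) Suc.prems(3,2)] show ?case by (auto simp: n(1))
qed

text \<open>Cutting the relator (st)^k of length 2k in the middle prepares the braid relation: the
  left half is the inverse of the alternating word ending in \<open>s\<close>.\<close>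

lemma replicate_alternating: "concat (replicate k [s, t]) = rev (alternating k t s) @ alternating k s t"
proof (induction k arbitrary: s t)
  case (Suc k)
  have "concat (replicate (Suc k) [s, t]) = s # concat (replicate k [t, s]) @ [t]"
    by (induction k) simp_all
  then show ?case using Suc[of t s] by simp
qed simp

context coxeter
begin

lemma alternating_braid:
  assumes "s \<in> S" "t \<in> S" "s \<noteq> t" "m s t = enat k"
  shows "act (alternating k s t) = act (alternating k t s)"
proof
  fix x
  have "act (rev (alternating k t s)) (act (alternating k s t) x) = x"
    using act_dihedral[OF assms, of x] by (simp add: replicate_alternating)
  then show "act (alternating k s t) x = act (alternating k t s) x"
    using act_rev'[OF alternating_lists[OF assms(2,1)]] by metis
qed

text \<open>The recursion is that of the Chebyshev polynomials of the second kind: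
  \<open>u k\<close> is U_{k-1}(c), that is sin(k \<theta>)/sin(\<theta>) for c = cos(\<theta>), and
  k for c = 1. The parity of the length decides which of the two coefficients belongs to
  e_s.\<close>

lemma alternating_root:
  assumes "s \<in> S" "t \<in> S" "s \<noteq> t"
    and "gram m s t = - c" "gram m t s = - c"
    and "u 0 = 0" "u 1 = 1" "\<And>k. u (Suc (Suc k)) = 2 * c * u (Suc k) - u k"
  shows "act (alternating k s t) (cvec s) =
      (if even k then (\<lambda>v. u (Suc k) * cvec s v + u k * cvec t v)
       else (\<lambda>v. u k * cvec s v + u (Suc k) * cvec t v))"
  using assms(1-5)
proof (induction k arbitrary: s t rule: less_induct)
  case (less k)
  have st: "refl_op S m t (cvec s) = (\<lambda>v. 1 * cvec s v + (2 * c) * cvec t v)"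
    using refl_op_cvec[OF fin less.prems(1)] less.prems by simp
  consider "k = 0" | "k = 1" | j where "k = Suc (Suc j)"
    by (metis One_nat_def not0_implies_Suc)
  then show ?case
  proof cases
    case 1
    then show ?thesis using assms(6,7) by simp
  next
    case 2
    then show ?thesis using assms(6,7) assms(8)[of 0] st by simp
  next
    case 3
    \<comment> \<open>This word ends in \<open>s\<close>, which negates e_s; what remains is the
      alternating word of length \<open>j\<close>.\<close>
    have 1: "act (alternating (Suc j) t s) (cvec s) = (\<lambda>v. - act (alternating j s t) (cvec s) v)"
      using less.prems(1) by (simp add: refl_op_self act_neg)
    have "act (alternating k s t) (cvec s) = act (alternating (Suc j) t s) (\<lambda>v. 1 * cvec s v + (2 * c) * cvec t v)"
      using st by (simp add: 3)
    also have "\<dots> = (\<lambda>v. - act (alternating j s t) (cvec s) v + 2 * c * act (alternating (Suc j) t s) (cvec t) v)"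
      unfolding refl_word_lin 1 by simp
    also have "\<dots> = (if even k then (\<lambda>v. u (Suc k) * cvec s v + u k * cvec t v)
       else (\<lambda>v. u k * cvec s v + u (Suc k) * cvec t v))"
      using less.IH[of j s t] less.IH[of "Suc j" t s] less.prems
      by (auto simp: 3 assms(8) algebra_simps)
    finally show ?thesis .
  qed
qed

text \<open>For an infinite label the coefficients are k and k + 1. For a finite label n they are
  sin(j pi/n)/sin(pi/n) with j = k and j = k + 1; the strict bound on k keeps both angles within
  [0, pi].\<close>

lemma alternating_root_nonneg:
  assumes "s \<in> S" "t \<in> S" "s \<noteq> t" "enat k < m s t"
  shows "\<exists>p q. 0 \<le> p \<and> 0 \<le> q \<and> act (alternating k s t) (cvec s) = (\<lambda>v. p * cvec s v + q * cvec t v)"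
proof (cases "m s t")
  case infinity
  then have "gram m s t = - 1" "gram m t s = - 1"
    using cox_sym[OF assms(1,2)] by (simp_all add: gram_def)
  then have "act (alternating k s t) (cvec s) =
      (if even k then (\<lambda>v. real (Suc k) * cvec s v + real k * cvec t v)
       else (\<lambda>v. real k * cvec s v + real (Suc k) * cvec t v))"
    using assms by (intro alternating_root[where c = 1]) auto
  then show ?thesis by (metis of_nat_0_le_iff)
next
  case (enat n)
  then have n: "2 \<le> n" "k < n"
    using cox_ge2[OF assms(1-3)] assms(4) by (simp_all add: numeral_eq_enat)
  define \<theta> where "\<theta> = pi / real n"
  have \<theta>: "0 < \<theta>" "real n * \<theta> = pi" using n by (simp_all add: \<theta>_def)
  have "\<theta> < pi" using n by (simp add: \<theta>_def divide_less_eq)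
  then have sin: "0 < sin \<theta>" using \<theta> by (intro sin_gt_zero)
  define u where "u j = sin (real j * \<theta>) / sin \<theta>" for j
  have u_nonneg: "0 \<le> u j" if "j \<le> n" for j
  proof -
    have "real j * \<theta> \<le> pi" using that \<theta> by (metis mult_right_mono less_imp_le of_nat_mono)
    then show ?thesis using sin \<theta> by (auto simp: u_def intro!: divide_nonneg_pos sin_ge_zero)
  qed
  have g: "gram m s t = - cos \<theta>" "gram m t s = - cos \<theta>"
    using cox_sym[OF assms(1,2)] enat unfolding gram_def \<theta>_def by (metis enat.simps(4))+
  have "u (Suc (Suc j)) = 2 * cos \<theta> * u (Suc j) - u j" for j
  proof -
    have "sin (real (Suc (Suc j)) * \<theta>) + sin (real j * \<theta>) = 2 * cos \<theta> * sin (real (Suc j) * \<theta>)"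
      using sin_add[of "real (Suc j) * \<theta>" \<theta>] sin_diff[of "real (Suc j) * \<theta>" \<theta>]
      by (simp add: algebra_simps)
    then have "sin (real (Suc (Suc j)) * \<theta>) = 2 * cos \<theta> * sin (real (Suc j) * \<theta>) - sin (real j * \<theta>)"
      by linarith
    then show ?thesis by (simp only: u_def diff_divide_distrib times_divide_eq_right)
  qed
  then have "act (alternating k s t) (cvec s) =
      (if even k then (\<lambda>v. u (Suc k) * cvec s v + u k * cvec t v)
       else (\<lambda>v. u k * cvec s v + u (Suc k) * cvec t v))"
    using assms g sin by (intro alternating_root[where c = "cos \<theta>"]) (auto simp: u_def)
  moreover have "0 \<le> u k" "0 \<le> u (Suc k)" using n by (simp_all add: u_nonneg)
  ultimately show ?thesis by metis
qed

section \<open>Reduced words and the sign of roots\<close>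

text \<open>Length and reducedness refer to the group of operators, so faithfulness of the representation is not
  required for the positivity theorem for roots.\<close>

definition reduced_in :: "'a set \<Rightarrow> 'a list \<Rightarrow> bool" where
  "reduced_in A ws \<longleftrightarrow> ws \<in> lists A \<and> (\<forall>vs\<in>lists A. act vs = act ws \<longrightarrow> length ws \<le> length vs)"

text \<open>For a reduced word this says that appending \<open>s\<close> does not shorten the
  operator. The weak inequality avoids any appeal to the parity of lengths.\<close>

definition ascent_in :: "'a set \<Rightarrow> 'a list \<Rightarrow> 'a \<Rightarrow> bool" where
  "ascent_in A ws s \<longleftrightarrow> (\<forall>vs\<in>lists A. act vs = act (ws @ [s]) \<longrightarrow> length ws \<le> length vs)"

lemma reduced_prefix:
  assumes "reduced_in A (vs @ ws)"
  shows "reduced_in A vs"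
  unfolding reduced_in_def
proof (intro conjI ballI impI)
  show "vs \<in> lists A" using assms by (simp add: reduced_in_def)
  fix us assume us: "us \<in> lists A" "act us = act vs"
  then have "us @ ws \<in> lists A" "act (us @ ws) = act (vs @ ws)"
    using assms by (auto simp: reduced_in_def)
  then have "length (vs @ ws) \<le> length (us @ ws)"
    using assms unfolding reduced_in_def by blast
  then show "length vs \<le> length us" by simp
qed

text \<open>A last letter \<open>s\<close> would cancel against the appended \<open>s\<close>, so
  the last letter is \<open>t\<close>. Since the whole word is reduced, \<open>t\<close> is an
  ascent of the prefix, and the induction continues with \<open>s\<close> and \<open>t\<close>
  exchanged.\<close>

lemma reduced_dihedral_alternating:
  assumes "s \<in> S" "t \<in> S" "reduced_in {s, t} ws" "ascent_in {s, t} ws s"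
  shows "ws = alternating (length ws) s t"
  using assms
proof (induction ws arbitrary: s t rule: rev_induct)
  case (snoc a ws)
  have "a \<noteq> s"
  proof
    assume a: "a = s"
    have "act ws = act ((ws @ [a]) @ [s])"
      using snoc.prems(1) by (intro ext) (simp add: a refl_op_invol)
    moreover have "ws \<in> lists {s, t}" using snoc.prems(3) by (simp add: reduced_in_def)
    ultimately have "length (ws @ [a]) \<le> length ws"
      using snoc.prems(4) unfolding ascent_in_def by blast
    then show False by simp
  qed
  then have a: "a = t" using snoc.prems(3) by (auto simp: reduced_in_def)
  have "reduced_in {t, s} ws"
    using reduced_prefix[OF snoc.prems(3)] by (simp add: insert_commute)
  moreover have "ascent_in {t, s} ws t"
    unfolding ascent_in_def
  proof (intro ballI impI)
    fix vs assume "vs \<in> lists {t, s}" "act vs = act (ws @ [t])"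
    then have "length (ws @ [t]) \<le> length vs"
      using snoc.prems(3) unfolding reduced_in_def a by (simp add: insert_commute)
    then show "length ws \<le> length vs" by simp
  qed
  ultimately have "ws = alternating (length ws) t s" using snoc.IH snoc.prems(1,2) by blast
  then show ?case by (simp add: a)
qed simp

text \<open>An ascent forces the alternating word to be shorter than the label: otherwise the braid
  relation rewrites its last \<open>m s t\<close> letters into a word ending in \<open>s\<close>,
  which cancels against the appended \<open>s\<close> and shortens the operator.\<close>

lemma dihedral_root_nonneg:
  assumes "s \<in> S" "t \<in> S" "s \<noteq> t" "reduced_in {s, t} ws" "ascent_in {s, t} ws s"
  shows "\<exists>p q. 0 \<le> p \<and> 0 \<le> q \<and> act ws (cvec s) = (\<lambda>v. p * cvec s v + q * cvec t v)"
proof -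
  define n where "n = length ws"
  have ws: "ws = alternating n s t" using reduced_dihedral_alternating assms unfolding n_def by blast
  have "enat n < m s t"
  proof (rule ccontr)
    assume "\<not> enat n < m s t"
    then obtain k where k: "m s t = enat k" "k \<le> n"
      by (cases "m s t") auto
    then obtain j where j: "k = Suc j"
      using cox_ge2[OF assms(1-3)] by (cases k) (auto simp: numeral_eq_enat)
    obtain ys where ys: "ys \<in> lists {s, t}" "ws = ys @ alternating k s t"
      using alternating_split[OF k(2), of s "{s, t}" t] ws by auto
    have "act (ys @ alternating j s t) = act (ws @ [s])"
    proof
      fix x
      have "act (ws @ [s]) x = act ys (act (alternating k t s) (refl_op S m s x))"
        using alternating_braid[OF assms(1-3) k(1)] by (simp add: ys(2))
      then show "act (ys @ alternating j s t) x = act (ws @ [s]) x"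
        using assms(1) by (simp add: j refl_op_invol)
    qed
    moreover have "ys @ alternating j s t \<in> lists {s, t}"
      using ys(1) alternating_lists[of s "{s, t}" t j] by simp
    ultimately have "length ws \<le> length (ys @ alternating j s t)"
      using assms(5) unfolding ascent_in_def by blast
    then show False by (simp add: ys(2) j)
  qed
  then show ?thesis using alternating_root_nonneg[OF assms(1-3)] ws by simp
qed

text \<open>Peel off from the right of the word a longest possible factor in the two letters \<open>s\<close> and \<open>t\<close>,
  where \<open>t\<close> is the last letter; the dihedral computation applies to it, the induction
  hypothesis to the rest.\<close>

lemma ascent_root_nonneg:
  assumes "reduced_in S ws" "ascent_in S ws s" "s \<in> S"
  shows "0 \<le> act ws (cvec s) u"
  using assms
proof (induction "length ws" arbitrary: ws s u rule: less_induct)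
  case less
  show ?case
  proof (cases ws rule: rev_cases)
    case Nil
    then show ?thesis by (simp add: cvec_def)
  next
    case (snoc w0 t)
    have tS: "t \<in> S" and w0: "w0 \<in> lists S"
      using less.prems(1) by (simp_all add: snoc reduced_in_def)
    have ws: "ws \<in> lists S" using less.prems(1) by (simp add: reduced_in_def)
    have min: "length ws \<le> length vs" if "vs \<in> lists S" "act vs = act ws" for vs
      using less.prems(1) that unfolding reduced_in_def by blast
    have "t \<noteq> s"
    proof
      assume "t = s"
      then have "act w0 = act (ws @ [s])"
        using less.prems(3) by (simp add: snoc refl_op_invol fun_eq_iff)
      then have "length ws \<le> length w0"
        using less.prems(2) w0 unfolding ascent_in_def by blast
      then show False by (simp add: snoc)
    qed
    define Q where "Q j \<longleftrightarrow> (\<exists>v x. v \<in> lists S \<and> x \<in> lists {s, t} \<and> act (v @ x) = act ws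
        \<and> length v + length x = length ws \<and> length v = j)" for j
    \<comment> \<open>Splitting off the single letter \<open>t\<close> shows that the least left
      factor is strictly shorter than \<open>ws\<close>, so the induction hypothesis will apply to
      it.\<close>
    have Q0: "Q (length w0)"
      unfolding Q_def using w0 by (intro exI[of _ w0] exI[of _ "[t]"]) (simp add: snoc)
    obtain v x where vx: "v \<in> lists S" "x \<in> lists {s, t}" "act (v @ x) = act ws"
      "length v + length x = length ws" "length v = (LEAST j. Q j)"
      using LeastI[of Q, OF Q0] unfolding Q_def by blast
    have xS: "x \<in> lists S" using vx(2) less.prems(3) tS by auto
    have lv: "length v < length ws"
      using Least_le[of Q, OF Q0] vx(5) by (simp add: snoc)
    have "reduced_in S (v @ x)"
      unfolding reduced_in_def using vx(1,3,4) xS min by simp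
    then have rv: "reduced_in S v" by (rule reduced_prefix)
    \<comment> \<open>If \<open>a\<close> shortened \<open>v\<close> to \<open>v'\<close>, then
      moving \<open>a\<close> to the front of \<open>x\<close> would give a factorization of the
      same total length with a shorter left factor, against the choice of \<open>v\<close>.\<close>
    have asc: "ascent_in S v a" if a: "a \<in> {s, t}" for a
      unfolding ascent_in_def
    proof (intro ballI impI)
      fix v' assume v': "v' \<in> lists S" "act v' = act (v @ [a])"
      have aS: "a \<in> S" using a less.prems(3) tS by auto
      show "length v \<le> length v'"
      proof (rule ccontr)
        assume len: "\<not> length v \<le> length v'"
        have eq: "act (v' @ a # x) = act ws"
        proof
          fix y
          have "act (v' @ a # x) y = act (v @ [a]) (refl_op S m a (act x y))"
            using v'(2) by simp
          also have "\<dots> = act (v @ x) y" using aS by (simp add: refl_op_invol)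
          finally show "act (v' @ a # x) y = act ws y" using vx(3) by simp
        qed
        have "v' @ a # x \<in> lists S" using v'(1) aS xS by simp
        then have "length ws \<le> length (v' @ a # x)" using min eq by blast
        then have "length v' + length (a # x) = length ws" using len vx(4) by simp
        moreover have "a # x \<in> lists {s, t}" using a vx(2) by simp
        ultimately have "Q (length v')"
          unfolding Q_def using v'(1) eq by blast
        then show False using Least_le[of Q] vx(5) len by fastforce
      qed
    qed
    have pos: "0 \<le> act v (cvec a) u" if "a \<in> {s, t}" for a u
      using less.hyps[OF lv rv asc[OF that]] that less.prems(3) tS by blast
    have "reduced_in {s, t} x"
      unfolding reduced_in_def
    proof (intro conjI ballI impI)
      fix x' assume x': "x' \<in> lists {s, t}" "act x' = act x"
      have "v @ x' \<in> lists S" using x'(1) vx(1) less.prems(3) tS by auto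
      moreover have "act (v @ x') = act ws" using x'(2) vx(3) by (simp only: refl_word_comp)
      ultimately have "length ws \<le> length (v @ x')" using min by blast
      then show "length x \<le> length x'" using vx(4) by simp
    qed (rule vx(2))
    moreover have "ascent_in {s, t} x s"
      unfolding ascent_in_def
    proof (intro ballI impI)
      fix x' assume x': "x' \<in> lists {s, t}" "act x' = act (x @ [s])"
      have "v @ x' \<in> lists S" using x'(1) vx(1) less.prems(3) tS by auto
      moreover have "act (v @ x') = act (ws @ [s])"
        using x'(2) vx(3) by (simp only: refl_word_comp comp_assoc[symmetric])
      ultimately have "length ws \<le> length (v @ x')"
        using less.prems(2) unfolding ascent_in_def by blast
      then show "length x \<le> length x'" using vx(4) by simp
    qed
    ultimately obtain p q where pq: "0 \<le> p" "0 \<le> q"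
      "act x (cvec s) = (\<lambda>v. p * cvec s v + q * cvec t v)"
      using dihedral_root_nonneg[OF less.prems(3) tS] \<open>t \<noteq> s\<close> by metis
    have "act ws (cvec s) = act v (act x (cvec s))" using vx(3) by (metis refl_word_append)
    also have "\<dots> = (\<lambda>u. p * act v (cvec s) u + q * act v (cvec t) u)"
      unfolding pq(3) refl_word_lin ..
    finally show ?thesis using pq(1,2) pos by simp
  qed
qed

lemma ex_reduced:
  assumes "ws \<in> lists S"
  obtains vs where "reduced_in S vs" "act vs = act ws"
proof -
  define Q where "Q vs \<longleftrightarrow> vs \<in> lists S \<and> act vs = act ws" for vs
  have "Q ws" using assms by (simp add: Q_def)
  then obtain vs where "Q vs" "\<And>us. Q us \<Longrightarrow> length vs \<le> length us"
    using ex_has_least_nat[of Q ws length] by blast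
  then have "reduced_in S vs" "act vs = act ws"
    unfolding reduced_in_def Q_def by metis+
  then show ?thesis using that by blast
qed

text \<open>If appending \<open>s\<close> shortens the operator, then \<open>s\<close> is an ascent
  of a reduced word for the shorter operator, whose root is the negative of the given one.\<close>

theorem root_sign:
  assumes "ws \<in> lists S" "s \<in> S"
  shows "(\<forall>u. 0 \<le> act ws (cvec s) u) \<or> (\<forall>u. act ws (cvec s) u \<le> 0)"
proof -
  obtain w where w: "reduced_in S w" "act w = act ws"
    using ex_reduced[OF assms(1)] by blast
  show ?thesis
  proof (cases "ascent_in S w s")
    case True
    then show ?thesis using ascent_root_nonneg[OF w(1) True assms(2)] w(2) by simp
  next
    case False
    then obtain v0 where v0: "v0 \<in> lists S" "act v0 = act (w @ [s])" "length v0 < length w"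
      unfolding ascent_in_def by (auto simp: not_le)
    obtain v where v: "reduced_in S v" "act v = act v0"
      using ex_reduced[OF v0(1)] by blast
    have "length v \<le> length v0" using v v0(1) unfolding reduced_in_def by metis
    moreover have "act (v @ [s]) = act w"
      using v(2) v0(2) assms(2) by (intro ext) (simp add: refl_op_invol)
    ultimately have "ascent_in S v s"
      using w(1) v0(3) unfolding ascent_in_def reduced_in_def by fastforce
    then have "0 \<le> act v (cvec s) u" for u
      using ascent_root_nonneg[OF v(1) _ assms(2)] by blast
    moreover have "act v (cvec s) = (\<lambda>u. - act ws (cvec s) u)"
      using v(2) v0(2) w(2) assms(2) by (simp add: refl_op_self act_neg)
    ultimately show ?thesis by simp
  qed
qed

section \<open>Coset representatives for a parabolic subgroup\<close>

lemma reduced_rev: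
  assumes "reduced_in S ws"
  shows "reduced_in S (rev ws)"
  unfolding reduced_in_def
proof (intro conjI ballI impI)
  have ws: "ws \<in> lists S" using assms by (simp add: reduced_in_def)
  then show "rev ws \<in> lists S" by simp
  fix vs assume vs: "vs \<in> lists S" "act vs = act (rev ws)"
  then have "act (rev vs) = act ws"
    using act_rev_cong[of vs "rev ws"] ws by simp
  moreover have "rev vs \<in> lists S" using vs by simp
  ultimately have "length ws \<le> length (rev vs)"
    using assms unfolding reduced_in_def by blast
  then show "length (rev ws) \<le> length vs" by simp
qed

text \<open>Choose the factorization with \<open>v\<close> shortest. A letter of \<open>T\<close>
  that shortens \<open>rev v\<close> from the right could be absorbed into \<open>u\<close>, so
  every letter of \<open>T\<close> is an ascent of \<open>rev v\<close>.\<close>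

lemma coset_decomposition:
  assumes "ws \<in> lists S" "T \<subseteq> S"
  obtains u v where "u \<in> lists T" "v \<in> lists S" "act ws = act (u @ v)"
    "\<And>t r. t \<in> T \<Longrightarrow> 0 \<le> act (rev v) (cvec t) r"
proof -
  define Q where "Q p \<longleftrightarrow> fst p \<in> lists T \<and> snd p \<in> lists S \<and> act ws = act (fst p @ snd p)" for p
  have "Q ([], ws)" using assms by (simp add: Q_def)
  then obtain p where p: "Q p" "\<And>q. Q q \<Longrightarrow> length (snd p) \<le> length (snd q)"
    using ex_has_least_nat[of Q _ "\<lambda>p. length (snd p)"] by metis
  obtain u v where uv: "p = (u, v)" by force
  have Q: "u \<in> lists T" "v \<in> lists S" "act ws = act (u @ v)"
    using p(1) by (simp_all add: Q_def uv)
  have min: "length v \<le> length v'"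
    if "u' \<in> lists T" "v' \<in> lists S" "act ws = act (u' @ v')" for u' v'
    using p(2)[of "(u', v')"] that by (simp add: Q_def uv)
  have "reduced_in S v"
    unfolding reduced_in_def
  proof (intro conjI ballI impI)
    fix v' assume v': "v' \<in> lists S" "act v' = act v"
    then have "act ws = act (u @ v')" using Q(3) by (simp only: refl_word_comp)
    then show "length v \<le> length v'" using min Q(1) v'(1) by blast
  qed (rule Q(2))
  then have red: "reduced_in S (rev v)" by (rule reduced_rev)
  have "ascent_in S (rev v) t" if t: "t \<in> T" for t
    unfolding ascent_in_def
  proof (intro ballI impI)
    have tS: "t \<in> S" using t assms(2) by blast
    fix v' assume v': "v' \<in> lists S" "act v' = act (rev v @ [t])"
    have "act (rev v') = act (rev (rev v @ [t]))"
      using v' Q(2) tS by (intro act_rev_cong) simp_all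
    then have "act ((u @ [t]) @ rev v') = act ws"
      using Q(3) tS by (intro ext) (simp add: refl_op_invol)
    then have "length v \<le> length (rev v')"
      using min[of "u @ [t]" "rev v'"] Q(1) t v'(1) by simp
    then show "length (rev v) \<le> length v'" by simp
  qed
  then have "0 \<le> act (rev v) (cvec t) r" if "t \<in> T" for t r
    using ascent_root_nonneg[OF red] that assms(2) by blast
  then show ?thesis using that Q by blast
qed

end

section \<open>The Tits cone and the hyperplanes in terms of roots\<close>

text \<open>This is the union of the translates of the closed dual chamber: \<open>f\<close> lies in
  the translate by w iff w^-1 f is nonnegative on the basis, and (w^-1 f)(e_t) = f(w e_t).\<close>

definition tits_union :: "'a set \<Rightarrow> ('a \<Rightarrow> 'a \<Rightarrow> enat) \<Rightarrow> ('a \<Rightarrow> real) set" where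
  "tits_union S m = {f \<in> extensional S. \<exists>ws\<in>lists S. \<forall>t\<in>S. 0 \<le> pairing S f (refl_word S m ws (cvec t))}"

text \<open>Hyperplanes are replaced by the roots w e_s that define them, so that group elements no
  longer occur.\<close>

definition complement_points ::
    "'a set \<Rightarrow> ('a \<Rightarrow> 'a \<Rightarrow> enat) \<Rightarrow> (('a \<Rightarrow> real) \<times> ('a \<Rightarrow> real)) set" where
  "complement_points S m = {(f, g). f \<in> tits_cone S m \<and> g \<in> extensional S \<and>
     (\<forall>ws\<in>lists S. \<forall>s\<in>S. \<not> (pairing S f (refl_word S m ws (cvec s)) = 0 \<and>
                           pairing S g (refl_word S m ws (cvec s)) = 0))}"

lemma map_fst_formal_inverse: "map fst (formal_inverse w) = rev (map fst w)"
  by (induction w) (auto simp: formal_inverse_def)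

lemma map_fst_words: "w \<in> words S \<Longrightarrow> map fst w \<in> lists S"
  by (auto simp: words_def in_lists_conv_set)

lemma topspace_powertop_real: "topspace (powertop_real S) = extensional S"
  by (auto simp: PiE_def)

lemma pairing_restrict: "pairing S f (restrict x S) = pairing S f x"
  by (simp add: pairing_def)

lemma pairing_lin: "pairing S f (\<lambda>u. p * x u + q * y u) = p * pairing S f x + q * pairing S f y"
  by (simp add: pairing_def sum_distrib_left sum.distrib algebra_simps)

lemma pairing_scale: "pairing S f (\<lambda>u. p * x u) = p * pairing S f x"
  using pairing_lin[of S f p x 0 x] by simp

lemma pairing_cvec:
  assumes "finite S" "t \<in> S"
  shows "pairing S f (cvec t) = f t"
proof -
  have "pairing S f (cvec t) = (\<Sum>s\<in>S. if s = t then f s else 0)"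
    unfolding pairing_def by (rule sum.cong) (auto simp: cvec_def)
  then show ?thesis using assms by simp
qed

lemma basis_vec_cvec: "basis_vec S t = restrict (cvec t) S"
  by (auto simp: basis_vec_def cvec_def)

lemma cvec_outside: "t \<in> S \<Longrightarrow> \<forall>u. u \<notin> S \<longrightarrow> cvec t u = 0"
  by (auto simp: cvec_def)

lemma refl_word_outside:
  assumes "ws \<in> lists S" "\<forall>u. u \<notin> S \<longrightarrow> x u = 0"
  shows "\<forall>u. u \<notin> S \<longrightarrow> refl_word R m ws x u = 0"
proof (intro allI impI)
  fix u assume u: "u \<notin> S"
  then have "u \<notin> set ws" using assms(1) by (auto simp: in_lists_conv_set)
  then show "refl_word R m ws x u = 0" using assms(2) u by (simp add: refl_word_other)
qed

lemma pairing_subset: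
  assumes "finite S" "T \<subseteq> S" "\<forall>u. u \<notin> T \<longrightarrow> x u = 0"
  shows "pairing T (restrict f T) x = pairing S f x"
proof -
  have "pairing T (restrict f T) x = (\<Sum>u\<in>T. f u * x u)"
    by (simp add: pairing_def)
  also have "\<dots> = (\<Sum>u\<in>S. f u * x u)"
    using assms by (intro sum.mono_neutral_left) auto
  finally show ?thesis by (simp add: pairing_def)
qed

lemma interior_of_powertop_real:
  assumes "finite S"
  shows "f \<in> powertop_real S interior_of A \<longleftrightarrow> f \<in> extensional S \<and>
    (\<exists>\<epsilon>>0. \<forall>g\<in>extensional S. (\<forall>s\<in>S. \<bar>g s - f s\<bar> < \<epsilon>) \<longrightarrow> g \<in> A)"
    (is "?L \<longleftrightarrow> ?R")
proof
  assume ?L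
  then obtain U where U: "openin (powertop_real S) U" "f \<in> U" "U \<subseteq> A"
    by (auto simp: interior_of_def)
  then have f: "f \<in> extensional S"
    using openin_subset topspace_powertop_real by blast
  obtain X where X: "\<forall>i\<in>S. openin euclideanreal (X i)" "f \<in> PiE S X" "PiE S X \<subseteq> U"
    using U(1,2) unfolding openin_product_topology_alt by blast
  have "\<exists>e>0. \<forall>y. \<bar>y - f s\<bar> < e \<longrightarrow> y \<in> X s" if "s \<in> S" for s
  proof -
    have "open (X s)" using X(1) that open_openin by blast
    moreover have "f s \<in> X s" using X(2) that by (rule PiE_mem)
    ultimately show ?thesis by (simp add: open_dist dist_real_def)
  qed
  then obtain e where e: "\<And>s. s \<in> S \<Longrightarrow> 0 < e s"
    "\<And>s y. s \<in> S \<Longrightarrow> \<bar>y - f s\<bar> < e s \<Longrightarrow> y \<in> X s"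
    by metis
  \<comment> \<open>The inserted 1 keeps the minimum defined when \<open>S\<close> is empty.\<close>
  define \<epsilon> where "\<epsilon> = Min (insert 1 (e ` S))"
  have "0 < \<epsilon>" using assms e(1) by (simp add: \<epsilon>_def)
  moreover have "g \<in> A" if g: "g \<in> extensional S" "\<forall>s\<in>S. \<bar>g s - f s\<bar> < \<epsilon>" for g
  proof -
    have "\<epsilon> \<le> e s" if "s \<in> S" for s
      using assms that by (simp add: \<epsilon>_def)
    then have "g s \<in> X s" if "s \<in> S" for s
      using e(2)[OF that] g(2) that by fastforce
    then have "g \<in> PiE S X" using g(1) by (auto simp: PiE_iff)
    then show ?thesis using X(3) U(3) by blast
  qed
  ultimately show ?R using f by blast
next
  assume ?R
  then obtain \<epsilon> where f: "f \<in> extensional S" and \<epsilon>: "\<epsilon> > 0"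
    "\<And>g. g \<in> extensional S \<Longrightarrow> \<forall>s\<in>S. \<bar>g s - f s\<bar> < \<epsilon> \<Longrightarrow> g \<in> A"
    by blast
  define B where "B = PiE S (\<lambda>s. {f s - \<epsilon><..<f s + \<epsilon>})"
  have "openin (powertop_real S) B"
    unfolding B_def openin_PiE[OF assms] using open_greaterThanLessThan open_openin by blast
  moreover have "f \<in> B" using f \<epsilon>(1) by (auto simp: B_def PiE_iff)
  moreover have "B \<subseteq> A"
  proof
    fix g assume g: "g \<in> B"
    then have "\<bar>g s - f s\<bar> < \<epsilon>" if "s \<in> S" for s
      using PiE_mem[of g S "\<lambda>s. {f s - \<epsilon><..<f s + \<epsilon>}" s] that by (auto simp: B_def abs_less_iff)
    then show "g \<in> A" using \<epsilon>(2) g by (auto simp: B_def PiE_iff)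
  qed
  ultimately show ?L unfolding interior_of_def by blast
qed

section \<open>The contragredient action in terms of words\<close>

context coxeter
begin

text \<open>The restricted abstraction is the pull-back of \<open>f\<close> along the operator,
  recorded by its values on the basis as in \<open>dual_act\<close>; by linearity it is the
  pull-back on all vectors.\<close>

lemma pairing_pull:
  assumes "\<forall>u. u \<notin> S \<longrightarrow> x u = 0"
  shows "pairing S (\<lambda>t\<in>S. pairing S f (act ws (cvec t))) x = pairing S f (act ws x)"
  unfolding pairing_expansion[OF fin assms]
  by (simp add: pairing_def mult.commute)

text \<open>Inverting a group element reverses a representing word and flips the signs of its
  letters, which the action ignores.\<close>

lemma dual_act_class:
  assumes w: "w \<in> words S"
  shows "dual_act S m (pres_rel S (coxeter_relators S m) `` {w}) f
    = (\<lambda>t\<in>S. pairing S f (act (rev (map fst w)) (cvec t)))"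
proof -
  let ?c = "\<lambda>w. pres_rel S (coxeter_relators S m) `` {w}"
  let ?G = "coxeter_group S m"
  interpret G: group ?G by (rule group_coxeter_group)
  have iw: "formal_inverse w \<in> words S" using w by (rule formal_inverse_words)
  have carr: "?c v \<in> carrier ?G" if "v \<in> words S" for v
    using that unfolding coxeter_group_def by (rule presented_group_class)
  have "?c (formal_inverse w) \<otimes>\<^bsub>?G\<^esub> ?c w = ?c (formal_inverse w @ w)"
    unfolding coxeter_group_def by (rule presented_group_mult[OF iw w])
  also have "\<dots> = \<one>\<^bsub>?G\<^esub>"
    unfolding coxeter_group_def presented_group_one
    by (intro equiv_class_eq[OF equiv_pres_rel])
      (simp add: pres_rel_def pres_eq_formal_inverse[OF w])
  finally have inv: "inv\<^bsub>?G\<^esub> (?c w) = ?c (formal_inverse w)"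
    using carr[OF w] carr[OF iw] G.inv_equality by blast
  have "pairing S f (canon_act S m (?c (formal_inverse w)) (basis_vec S t))
      = pairing S f (act (rev (map fst w)) (cvec t))" for t
  proof -
    have "canon_act S m (?c (formal_inverse w)) (basis_vec S t)
        = word_act S m (formal_inverse w) (restrict (cvec t) S)"
      using canon_act_class[OF cox iw] by (simp add: basis_vec_cvec)
    also have "\<dots> = restrict (act (rev (map fst w)) (cvec t)) S"
      using word_act_refl_word[OF fin, of "formal_inverse w"] map_fst_words[OF w]
      by (simp add: map_fst_formal_inverse)
    finally show ?thesis by (simp only: pairing_restrict)
  qed
  then show ?thesis by (simp add: dual_act_def inv)
qed

lemma carrier_coxeter_group:
  "carrier (coxeter_group S m) = (\<lambda>w. pres_rel S (coxeter_relators S m) `` {w}) ` words S"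
  by (auto simp: coxeter_group_def presented_group_def quotient_def)

lemma lift_word: "ws \<in> lists S \<Longrightarrow> \<exists>w\<in>words S. map fst w = ws"
  by (intro bexI[of _ "map (\<lambda>s. (s, True)) ws"]) (auto simp: words_def in_lists_conv_set comp_def)

lemma tits_cone_eq: "tits_cone S m = powertop_real S interior_of tits_union S m"
proof -
  let ?c = "\<lambda>w. pres_rel S (coxeter_relators S m) `` {w}"
  have "(\<Union>g\<in>carrier (coxeter_group S m). dual_act S m g ` dual_chamber S)
      = (\<Union>w\<in>words S. dual_act S m (?c w) ` dual_chamber S)"
    by (simp add: carrier_coxeter_group)
  also have "\<dots> = tits_union S m"
  proof (intro subset_antisym subsetI)
    fix f assume "f \<in> (\<Union>w\<in>words S. dual_act S m (?c w) ` dual_chamber S)"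
    then obtain w d where w: "w \<in> words S" and d: "d \<in> dual_chamber S"
      and f: "f = dual_act S m (?c w) d" by blast
    let ?ws = "map fst w"
    have ws: "?ws \<in> lists S" using w by (rule map_fst_words)
    have "pairing S f (act ?ws (cvec t)) = d t" if "t \<in> S" for t
      using pairing_pull[OF refl_word_outside[OF ws cvec_outside[OF that]], of d "rev ?ws"]
        act_rev[OF ws] pairing_cvec[OF fin that]
      by (simp add: f dual_act_class[OF w])
    moreover have "f \<in> extensional S" by (simp add: f dual_act_def)
    ultimately show "f \<in> tits_union S m"
      using d ws unfolding tits_union_def dual_chamber_def mem_Collect_eq by metis
  next
    fix f assume "f \<in> tits_union S m"
    then obtain ws where f: "f \<in> extensional S" and ws: "ws \<in> lists S"
      and pos: "\<And>t. t \<in> S \<Longrightarrow> 0 \<le> pairing S f (act ws (cvec t))"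
      by (auto simp: tits_union_def)
    obtain w where w: "w \<in> words S" "map fst w = ws" using lift_word[OF ws] by blast
    \<comment> \<open>The point of the chamber is w^-1 f.\<close>
    define d where "d = (\<lambda>t\<in>S. pairing S f (act ws (cvec t)))"
    have rws: "rev ws \<in> lists S" using ws by simp
    have "dual_act S m (?c w) d = (\<lambda>t\<in>S. pairing S d (act (rev ws) (cvec t)))"
      by (simp add: dual_act_class[OF w(1)] w(2))
    also have "\<dots> = (\<lambda>t\<in>S. f t)"
      unfolding d_def
      by (intro restrict_ext) (simp add: pairing_pull[OF refl_word_outside[OF rws cvec_outside]]
          act_rev'[OF ws] pairing_cvec[OF fin])
    also have "\<dots> = f" using f by (simp add: extensional_restrict)
    finally have "f = dual_act S m (?c w) d" ..
    moreover have "d \<in> dual_chamber S"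
      using pos by (auto simp: dual_chamber_def topspace_powertop_real d_def simp del: topspace_product_topology)
    ultimately show "f \<in> (\<Union>w\<in>words S. dual_act S m (?c w) ` dual_chamber S)"
      using w(1) by blast
  qed
  finally show ?thesis by (simp add: tits_cone_def)
qed

section \<open>Reflection hyperplanes as kernels of roots\<close>

text \<open>With \<beta> = w e_s, the reflection w s w^-1 changes each vector by a multiple of
  \<beta>, so it fixes every functional vanishing at \<beta>. Conversely it negates \<beta>, so a
  fixed functional takes opposite, hence zero, values there.\<close>

lemma hyperplane_class:
  assumes w: "w \<in> words S" and s: "s \<in> S"
  shows "hyperplane S m (pres_rel S (coxeter_relators S m) `` {w @ [(s, True)] @ formal_inverse w})
    = {f \<in> extensional S. pairing S f (act (map fst w) (cvec s)) = 0}"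
proof -
  define ws where "ws = map fst w"
  define \<beta> where "\<beta> = act ws (cvec s)"
  have ws: "ws \<in> lists S" using w map_fst_words unfolding ws_def by blast
  have v: "w @ [(s, True)] @ formal_inverse w \<in> words S"
    using w s formal_inverse_words[OF w] by (simp add: words_def)
  have mv: "rev (map fst (w @ [(s, True)] @ formal_inverse w)) = ws @ [s] @ rev ws"
    by (simp add: map_fst_formal_inverse ws_def)
  have refl: "act (ws @ [s] @ rev ws) x
      = (\<lambda>u. 1 * x u + (- 2 * (\<Sum>u\<in>S. act (rev ws) x u * gram m u s)) * \<beta> u)" for x
  proof -
    have "refl_op S m s y = (\<lambda>u. 1 * y u + (- 2 * (\<Sum>u\<in>S. y u * gram m u s)) * cvec s u)" for y
      by (auto simp: refl_op_def cvec_def)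
    then have "act (ws @ [s] @ rev ws) x
        = act ws (\<lambda>u. 1 * act (rev ws) x u + (- 2 * (\<Sum>u\<in>S. act (rev ws) x u * gram m u s)) * cvec s u)"
      by simp
    also have "\<dots> = (\<lambda>u. 1 * act ws (act (rev ws) x) u
        + (- 2 * (\<Sum>u\<in>S. act (rev ws) x u * gram m u s)) * \<beta> u)"
      unfolding refl_word_lin \<beta>_def ..
    finally show ?thesis by (simp only: act_rev'[OF ws])
  qed
  have \<beta>_out: "\<forall>u. u \<notin> S \<longrightarrow> \<beta> u = 0"
    unfolding \<beta>_def by (intro refl_word_outside ws cvec_outside s)
  have neg: "act (ws @ [s] @ rev ws) \<beta> = (\<lambda>u. - \<beta> u)"
    by (simp add: \<beta>_def act_rev[OF ws] refl_op_self[OF s] act_neg)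
  have "(\<lambda>t\<in>S. pairing S f (act (ws @ [s] @ rev ws) (cvec t))) = f \<longleftrightarrow> pairing S f \<beta> = 0"
    if f: "f \<in> extensional S" for f
  proof
    assume "(\<lambda>t\<in>S. pairing S f (act (ws @ [s] @ rev ws) (cvec t))) = f"
    then have "pairing S f \<beta> = pairing S f (act (ws @ [s] @ rev ws) \<beta>)"
      using pairing_pull[OF \<beta>_out] by metis
    also have "\<dots> = - pairing S f \<beta>"
      unfolding neg by (simp add: pairing_def sum_negf)
    finally show "pairing S f \<beta> = 0" by simp
  next
    assume 0: "pairing S f \<beta> = 0"
    have "pairing S f (act (ws @ [s] @ rev ws) (cvec t)) = f t" if "t \<in> S" for t
      unfolding refl pairing_lin 0 using that by (simp add: pairing_cvec[OF fin])
    then show "(\<lambda>t\<in>S. pairing S f (act (ws @ [s] @ rev ws) (cvec t))) = f"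
      using f by (auto simp: extensional_def)
  qed
  then show ?thesis
    unfolding hyperplane_def dual_act_class[OF v] mv topspace_powertop_real \<beta>_def ws_def
    by blast
qed

lemma reflections_eq:
  "reflections S m = {pres_rel S (coxeter_relators S m) `` {w @ [(s, True)] @ formal_inverse w}
     | s w. s \<in> S \<and> w \<in> words S}"
proof -
  let ?c = "\<lambda>w. pres_rel S (coxeter_relators S m) `` {w}"
  let ?G = "coxeter_group S m"
  interpret G: group ?G by (rule group_coxeter_group)
  have mult: "?c v \<otimes>\<^bsub>?G\<^esub> ?c w = ?c (v @ w)" if "v \<in> words S" "w \<in> words S" for v w
    using that unfolding coxeter_group_def by (rule presented_group_mult)
  have eq: "?c w \<otimes>\<^bsub>?G\<^esub> generator S m s \<otimes>\<^bsub>?G\<^esub> inv\<^bsub>?G\<^esub> (?c w) = ?c (w @ [(s, True)] @ formal_inverse w)"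
    if w: "w \<in> words S" and s: "s \<in> S" for w s
  proof -
    have iw: "formal_inverse w \<in> words S" using w by (rule formal_inverse_words)
    have "?c (formal_inverse w) \<otimes>\<^bsub>?G\<^esub> ?c w = \<one>\<^bsub>?G\<^esub>"
      unfolding mult[OF iw w] unfolding coxeter_group_def presented_group_one
      by (intro equiv_class_eq[OF equiv_pres_rel])
        (simp add: pres_rel_def pres_eq_formal_inverse[OF w])
    moreover have "?c w \<in> carrier ?G" "?c (formal_inverse w) \<in> carrier ?G"
      using w iw by (auto simp: carrier_coxeter_group)
    ultimately have inv: "inv\<^bsub>?G\<^esub> (?c w) = ?c (formal_inverse w)"
      using G.inv_equality by blast
    have sw: "[(s, True)] \<in> words S" using s by (simp add: words_def)
    have wsw: "w @ [(s, True)] \<in> words S" using w sw by simp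
    show ?thesis
      unfolding inv generator_def mult[OF w sw] mult[OF wsw iw] by simp
  qed
  show ?thesis
  proof (intro subset_antisym subsetI)
    fix r assume "r \<in> reflections S m"
    then obtain s g where s: "s \<in> S" and g: "g \<in> carrier ?G"
      and r: "r = g \<otimes>\<^bsub>?G\<^esub> generator S m s \<otimes>\<^bsub>?G\<^esub> inv\<^bsub>?G\<^esub> g"
      unfolding reflections_def by blast
    obtain w where "w \<in> words S" "g = ?c w" using g unfolding carrier_coxeter_group by blast
    then show "r \<in> {?c (w @ [(s, True)] @ formal_inverse w) | s w. s \<in> S \<and> w \<in> words S}"
      using r eq s by blast
  next
    fix r assume "r \<in> {?c (w @ [(s, True)] @ formal_inverse w) | s w. s \<in> S \<and> w \<in> words S}"
    then obtain s w where s: "s \<in> S" and w: "w \<in> words S"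
      and r: "r = ?c (w @ [(s, True)] @ formal_inverse w)" by blast
    have "?c w \<in> carrier ?G" using w unfolding carrier_coxeter_group by blast
    then show "r \<in> reflections S m"
      unfolding reflections_def r eq[OF w s, symmetric] using s by blast
  qed
qed

lemma arrangement_complement_eq:
  "arrangement_complement S m
    = subtopology (prod_topology (powertop_real S) (powertop_real S)) (complement_points S m)"
proof -
  have ext: "tits_cone S m \<subseteq> extensional S"
    unfolding tits_cone_def using interior_of_subset_topspace topspace_powertop_real by metis
  have eq: "(f, g) \<in> (\<Union>r\<in>reflections S m. hyperplane S m r \<times> hyperplane S m r) \<longleftrightarrow>
      (\<exists>ws\<in>lists S. \<exists>s\<in>S. pairing S f (act ws (cvec s)) = 0 \<and> pairing S g (act ws (cvec s)) = 0)"
    if fg: "f \<in> extensional S" "g \<in> extensional S" for f g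
  proof -
    let ?r = "\<lambda>w s. pres_rel S (coxeter_relators S m) `` {w @ [(s, True)] @ formal_inverse w}"
    have mem: "h \<in> hyperplane S m (?r w s) \<longleftrightarrow> pairing S h (act (map fst w) (cvec s)) = 0"
      if "h \<in> extensional S" "w \<in> words S" "s \<in> S" for h w s
      using that(1) by (simp only: hyperplane_class[OF that(2,3)] mem_Collect_eq simp_thms)
    have "(f, g) \<in> (\<Union>r\<in>reflections S m. hyperplane S m r \<times> hyperplane S m r) \<longleftrightarrow>
        (\<exists>w\<in>words S. \<exists>s\<in>S. f \<in> hyperplane S m (?r w s) \<and> g \<in> hyperplane S m (?r w s))"
      unfolding reflections_eq by blast
    also have "\<dots> \<longleftrightarrow> (\<exists>w\<in>words S. \<exists>s\<in>S. pairing S f (act (map fst w) (cvec s)) = 0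
          \<and> pairing S g (act (map fst w) (cvec s)) = 0)"
      using mem[OF fg(1)] mem[OF fg(2)] by (intro bex_cong refl) simp
    also have "\<dots> \<longleftrightarrow> (\<exists>ws\<in>map fst ` words S. \<exists>s\<in>S. pairing S f (act ws (cvec s)) = 0
          \<and> pairing S g (act ws (cvec s)) = 0)"
      by (simp only: bex_simps)
    also have "map fst ` words S = lists S"
      using map_fst_words lift_word by blast
    finally show ?thesis .
  qed
  have "(f, g) \<in> tits_cone S m \<times> extensional S
      - (\<Union>r\<in>reflections S m. hyperplane S m r \<times> hyperplane S m r)
      \<longleftrightarrow> (f, g) \<in> complement_points S m" for f g
  proof (cases "f \<in> tits_cone S m \<and> g \<in> extensional S")
    case True
    then have fg: "f \<in> extensional S" "g \<in> extensional S" using ext by blast+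
    show ?thesis
      unfolding Diff_iff eq[OF fg] by (simp add: complement_points_def True)
  next
    case False
    then show ?thesis by (auto simp: complement_points_def)
  qed
  then have "tits_cone S m \<times> topspace (powertop_real S)
      - (\<Union>r\<in>reflections S m. hyperplane S m r \<times> hyperplane S m r) = complement_points S m"
    unfolding topspace_powertop_real by (intro equalityI subrelI) (simp_all only:)
  then show ?thesis unfolding arrangement_complement_def by simp
qed

end

section \<open>Parabolic subgroups\<close>

lemma ex_positive_lower_bound:
  fixes d :: "'a \<Rightarrow> real"
  assumes "finite S" "\<forall>s\<in>S. 0 < d s"
  shows "\<exists>\<epsilon>>0. \<forall>s\<in>S. \<epsilon> \<le> d s"
  using assms by (intro exI[of _ "Min (insert 1 (d ` S))"]) auto

lemma coxeter_matrix_subset: "coxeter_matrix S m \<Longrightarrow> T \<subseteq> S \<Longrightarrow> coxeter_matrix T m"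
  unfolding coxeter_matrix_def by (meson finite_subset subsetD)

locale parabolic = coxeter S m for S :: "'a set" and m +
  fixes T :: "'a set"
  assumes TS: "T \<subseteq> S"
begin

sublocale T: coxeter T m
  using coxeter_matrix_subset[OF cox TS] by unfold_locales

lemma lists_TS: "ws \<in> lists T \<Longrightarrow> ws \<in> lists S"
  using TS lists_mono by blast

lemma T_act: "ws \<in> lists T \<Longrightarrow> t \<in> T \<Longrightarrow> T.act ws (cvec t) = act ws (cvec t)"
  by (intro refl_word_subset fin TS cvec_outside)

lemma T_pairing:
  assumes "ws \<in> lists T" "t \<in> T"
  shows "pairing T (restrict f T) (T.act ws (cvec t)) = pairing S f (act ws (cvec t))"
  unfolding T_act[OF assms] using assms
  by (intro pairing_subset fin TS refl_word_outside cvec_outside)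

section \<open>Restriction of functionals from \<open>S\<close> to \<open>T\<close>\<close>

text \<open>If \<open>f\<close> lies in the chamber of w = u v, then its restriction lies in that of
  u: the vector u e_t equals w (v^-1 e_t), and v^-1 e_t is a nonnegative combination of basis
  vectors.\<close>

lemma restrict_tits_union:
  assumes "f \<in> tits_union S m"
  shows "restrict f T \<in> tits_union T m"
proof -
  obtain ws where ws: "ws \<in> lists S" and pos: "\<And>t. t \<in> S \<Longrightarrow> 0 \<le> pairing S f (act ws (cvec t))"
    using assms by (auto simp: tits_union_def)
  obtain u v where uv: "u \<in> lists T" "v \<in> lists S" "act ws = act (u @ v)"
    "\<And>t r. t \<in> T \<Longrightarrow> 0 \<le> act (rev v) (cvec t) r"
    using coset_decomposition[OF ws TS] by blast
  have "0 \<le> pairing T (restrict f T) (T.act u (cvec t))" if t: "t \<in> T" for t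
  proof -
    have tS: "t \<in> S" and rv: "rev v \<in> lists S" using t TS uv(2) by auto
    have "act u (cvec t) = act ws (act (rev v) (cvec t))"
      by (simp add: uv(3) act_rev'[OF uv(2)])
    then have "pairing S f (act u (cvec t))
        = (\<Sum>r\<in>S. act (rev v) (cvec t) r * pairing S f (act ws (cvec r)))"
      using pairing_expansion[OF fin refl_word_outside[OF rv cvec_outside[OF tS]]] by simp
    also have "\<dots> \<ge> 0"
      using uv(4)[OF t] pos by (intro sum_nonneg mult_nonneg_nonneg) auto
    finally show ?thesis using T_pairing[OF uv(1) t] by simp
  qed
  then show ?thesis using uv(1) by (auto simp: tits_union_def)
qed

lemma tits_cone_iff:
  "f \<in> tits_cone S m \<longleftrightarrow> f \<in> extensional S \<and>
    (\<exists>\<epsilon>>0. \<forall>g\<in>extensional S. (\<forall>s\<in>S. \<bar>g s - f s\<bar> < \<epsilon>) \<longrightarrow> g \<in> tits_union S m)"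
  unfolding tits_cone_eq by (rule interior_of_powertop_real[OF fin])

lemma T_tits_cone_iff:
  "f \<in> tits_cone T m \<longleftrightarrow> f \<in> extensional T \<and>
    (\<exists>\<epsilon>>0. \<forall>g\<in>extensional T. (\<forall>t\<in>T. \<bar>g t - f t\<bar> < \<epsilon>) \<longrightarrow> g \<in> tits_union T m)"
  unfolding T.tits_cone_eq by (rule interior_of_powertop_real[OF T.fin])

lemma restrict_tits_cone:
  assumes "f \<in> tits_cone S m"
  shows "restrict f T \<in> tits_cone T m"
proof -
  obtain \<epsilon> where \<epsilon>: "\<epsilon> > 0"
    "\<And>g. g \<in> extensional S \<Longrightarrow> \<forall>s\<in>S. \<bar>g s - f s\<bar> < \<epsilon> \<Longrightarrow> g \<in> tits_union S m"
    using assms unfolding tits_cone_iff by blast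
  have "g \<in> tits_union T m" if g: "g \<in> extensional T" "\<forall>t\<in>T. \<bar>g t - restrict f T t\<bar> < \<epsilon>" for g
  proof -
    \<comment> \<open>Restriction is open: a functional on \<open>T\<close> near the restriction of
      \<open>f\<close> is prolonged by the values of \<open>f\<close>, which stays within \<epsilon>
      of \<open>f\<close>.\<close>
    define h where "h = (\<lambda>s\<in>S. if s \<in> T then g s else f s)"
    have "h \<in> tits_union S m" using g(2) \<epsilon>(1) by (intro \<epsilon>(2)) (auto simp: h_def)
    then have "restrict h T \<in> tits_union T m" by (rule restrict_tits_union)
    moreover have "restrict h T = g"
      using g(1) TS by (auto simp: h_def extensional_def restrict_def fun_eq_iff)
    ultimately show ?thesis by simp
  qed
  then show ?thesis using \<epsilon>(1) unfolding T_tits_cone_iff by (intro conjI exI[of _ \<epsilon>]) auto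
qed

lemma restrict_complement_points:
  assumes "(f, g) \<in> complement_points S m"
  shows "(restrict f T, restrict g T) \<in> complement_points T m"
proof -
  have fg: "f \<in> tits_cone S m"
    "\<And>ws s. ws \<in> lists S \<Longrightarrow> s \<in> S \<Longrightarrow>
      \<not> (pairing S f (act ws (cvec s)) = 0 \<and> pairing S g (act ws (cvec s)) = 0)"
    using assms unfolding complement_points_def by blast+
  have "\<not> (pairing T (restrict f T) (T.act ws (cvec t)) = 0 \<and>
      pairing T (restrict g T) (T.act ws (cvec t)) = 0)" if "ws \<in> lists T" "t \<in> T" for ws t
    unfolding T_pairing[OF that] using that TS by (intro fg(2) lists_TS) auto
  then show ?thesis
    unfolding complement_points_def using restrict_tits_cone[OF fg(1)] by simp
qed

section \<open>Extension of functionals from \<open>T\<close> to \<open>S\<close>\<close>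

text \<open>Together with \<open>root_sign\<close> this keeps \<open>f\<close> off every hyperplane
  whose root is not supported in \<open>T\<close>.\<close>

definition positive_off :: "('a \<Rightarrow> real) \<Rightarrow> bool" where
  "positive_off f \<longleftrightarrow> (\<forall>ws\<in>lists S. \<forall>s\<in>S. (\<forall>u. 0 \<le> act ws (cvec s) u) \<longrightarrow>
     (\<exists>u. u \<notin> T \<and> act ws (cvec s) u \<noteq> 0) \<longrightarrow> 0 < pairing S f (act ws (cvec s)))"

text \<open>Letters in \<open>T\<close> leave the coordinates outside \<open>T\<close> alone, so the
  root keeps the coordinate 1 at \<open>s\<close>, and one positive coordinate fixes the sign of a
  root.\<close>

lemma off_root:
  assumes "ws \<in> lists T" "s \<in> S - T"
  shows "act ws (cvec s) s = 1" "0 \<le> act ws (cvec s) u"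
    "\<And>r. r \<notin> T \<Longrightarrow> r \<noteq> s \<Longrightarrow> act ws (cvec s) r = 0"
proof -
  have off: "act ws (cvec s) r = cvec s r" if "r \<notin> T" for r
    using assms(1) that by (intro refl_word_other) auto
  show 1: "act ws (cvec s) s = 1" using off[of s] assms(2) by (simp add: cvec_def)
  show "act ws (cvec s) r = 0" if "r \<notin> T" "r \<noteq> s" for r
    using off[OF that(1)] that(2) by (simp add: cvec_def)
  have "\<not> (\<forall>u. act ws (cvec s) u \<le> 0)"
    using 1 by (metis not_one_le_zero)
  then show "0 \<le> act ws (cvec s) u"
    using root_sign[OF lists_TS[OF assms(1)], of s] assms(2) by blast
qed

text \<open>A nonnegative root is monotone in the functional, so it is enough to control one functional
  \<open>p\<close> below \<open>f\<close>. If \<open>p\<close> lies in the chamber of \<open>u\<close>, then so does its extension by large values,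
  and the positive roots not supported in \<open>T\<close> remain positive under \<open>u\<inverse>\<close>.\<close>

lemma ex_positive_off_bound:
  assumes "p \<in> tits_union T m"
  obtains c where "\<And>f. \<forall>t\<in>T. p t \<le> f t \<Longrightarrow> \<forall>s\<in>S - T. c < f s \<Longrightarrow> positive_off f"
proof -
  obtain u where u: "u \<in> lists T" and pos: "\<And>t. t \<in> T \<Longrightarrow> 0 \<le> pairing T p (T.act u (cvec t))"
    and p: "p \<in> extensional T"
    using assms by (auto simp: tits_union_def)
  define b where "b s = (\<Sum>t\<in>T. p t * act u (cvec s) t)" for s
  \<comment> \<open>For \<open>r\<close> outside \<open>T\<close>, the vector u e_r is e_r plus a
    vector supported in \<open>T\<close> that contributes \<open>b r\<close>. As \<open>c\<close>
    dominates every absolute value of \<open>b r\<close>, the sum \<open>b r + f r\<close> is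
    positive once \<open>f r\<close> exceeds \<open>c\<close>.\<close>
  define c where "c = (\<Sum>s\<in>S. \<bar>b s\<bar>)"
  have "positive_off f" if f: "\<forall>t\<in>T. p t \<le> f t" "\<forall>s\<in>S - T. c < f s" for f
    unfolding positive_off_def
  proof (intro ballI impI)
    fix ws s assume ws: "ws \<in> lists S" and s: "s \<in> S"
      and nonneg: "\<forall>u. 0 \<le> act ws (cvec s) u"
      and off: "\<exists>u. u \<notin> T \<and> act ws (cvec s) u \<noteq> 0"
    define \<gamma> where "\<gamma> = act ws (cvec s)"
    define \<delta> where "\<delta> = act (rev u) \<gamma>"
    \<comment> \<open>Lowering \<open>f\<close> to \<open>p\<close> on \<open>T\<close> gives a
      functional below \<open>f\<close> to which the chamber condition for \<open>u\<close>
      applies.\<close>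
    define q where "q r = (if r \<in> T then p r else f r)" for r
    have q_T: "0 \<le> pairing S q (act u (cvec t))" if t: "t \<in> T" for t
    proof -
      have "restrict q T = p" using p by (auto simp: q_def extensional_def restrict_def fun_eq_iff)
      then show ?thesis using pos[OF t] T_pairing[OF u t, of q] by simp
    qed
    have q_off: "0 < pairing S q (act u (cvec r))" if r: "r \<in> S - T" for r
    proof -
      have "pairing S q (act u (cvec r))
          = (\<Sum>x\<in>T. q x * act u (cvec r) x) + (\<Sum>x\<in>S - T. q x * act u (cvec r) x)"
        unfolding pairing_def using sum.subset_diff[OF TS fin] by (simp add: add.commute)
      also have "(\<Sum>x\<in>T. q x * act u (cvec r) x) = b r"
        by (simp add: b_def q_def)
      also have "(\<Sum>x\<in>S - T. q x * act u (cvec r) x) = (\<Sum>x\<in>S - T. if x = r then f r else 0)"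
        using off_root(1,3)[OF u r] by (intro sum.cong) (auto simp: q_def)
      also have "\<dots> = f r" using r fin by simp
      finally have "pairing S q (act u (cvec r)) = b r + f r" .
      moreover have "\<bar>b r\<bar> \<le> c"
        unfolding c_def using r fin by (intro member_le_sum) auto
      moreover have "c < f r" using f(2) r by blast
      ultimately show ?thesis by linarith
    qed
    have \<delta>_root: "\<delta> = act (rev u @ ws) (cvec s)" by (simp add: \<delta>_def \<gamma>_def)
    have lw: "rev u @ ws \<in> lists S" using lists_TS[OF u] ws by simp
    have \<delta>_out: "\<forall>r. r \<notin> S \<longrightarrow> \<delta> r = 0"
      unfolding \<delta>_root by (intro refl_word_outside lw cvec_outside s)
    obtain r where r: "r \<notin> T" "\<gamma> r \<noteq> 0" using off \<gamma>_def by blast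
    \<comment> \<open>The letters of \<open>u\<close> lie in \<open>T\<close>, so \<delta> inherits
      a positive coordinate outside \<open>T\<close> and is therefore a nonnegative root.\<close>
    have "\<delta> r = \<gamma> r"
      unfolding \<delta>_def using u r(1) by (intro refl_word_other) auto
    then have \<delta>r: "0 < \<delta> r" using r(2) nonneg \<gamma>_def by (metis less_eq_real_def)
    then have rS: "r \<in> S - T" using \<delta>_out r(1) by force
    have \<delta>_nonneg: "0 \<le> \<delta> x" for x
      using root_sign[OF lw s] \<delta>r unfolding \<delta>_root by (meson not_le)
    have "\<gamma> = act u \<delta>" by (simp add: \<delta>_def act_rev'[OF lists_TS[OF u]])
    then have "pairing S q \<gamma> = (\<Sum>x\<in>S. \<delta> x * pairing S q (act u (cvec x)))"
      using pairing_expansion[OF fin \<delta>_out] by simp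
    also have "\<dots> > 0"
    proof (rule sum_pos2[OF fin])
      show "r \<in> S" using rS by simp
      show "0 < \<delta> r * pairing S q (act u (cvec r))" using \<delta>r q_off[OF rS] by simp
      show "0 \<le> \<delta> x * pairing S q (act u (cvec x))" if "x \<in> S" for x
        using \<delta>_nonneg q_T[of x] q_off[of x] that by (cases "x \<in> T") (auto intro: less_imp_le)
    qed
    finally have "0 < pairing S q \<gamma>" .
    also have "\<dots> \<le> pairing S f \<gamma>"
      unfolding pairing_def using f(1) nonneg
      by (intro sum_mono mult_right_mono) (auto simp: q_def \<gamma>_def)
    finally show "0 < pairing S f (act ws (cvec s))" by (simp add: \<gamma>_def)
  qed
  then show ?thesis using that by blast
qed

text \<open>The word \<open>u\<close> whose chamber contains the restriction also serves for
  \<open>f\<close>: for \<open>s\<close> outside \<open>T\<close> the root u e_s is nonnegative and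
  not supported in \<open>T\<close>.\<close>

lemma tits_union_extension:
  assumes "f \<in> extensional S" "restrict f T \<in> tits_union T m" "positive_off f"
  shows "f \<in> tits_union S m"
proof -
  obtain u where u: "u \<in> lists T" and pos: "\<And>t. t \<in> T \<Longrightarrow> 0 \<le> pairing T (restrict f T) (T.act u (cvec t))"
    using assms(2) by (auto simp: tits_union_def)
  have "0 \<le> pairing S f (act u (cvec s))" if s: "s \<in> S" for s
  proof (cases "s \<in> T")
    case True
    then show ?thesis using pos[OF True] T_pairing[OF u True, of f] by simp
  next
    case False
    then have sST: "s \<in> S - T" using s by simp
    have "\<exists>r. r \<notin> T \<and> act u (cvec s) r \<noteq> 0"
      using off_root(1)[OF u sST] False by (intro exI[of _ s]) simp
    then have "0 < pairing S f (act u (cvec s))"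
      using assms(3) lists_TS[OF u] s off_root(2)[OF u sST] unfolding positive_off_def by blast
    then show ?thesis by simp
  qed
  then show ?thesis using assms(1) lists_TS[OF u] by (auto simp: tits_union_def)
qed

text \<open>The open orthants above points \<open>p\<close> of the Tits union of \<open>T\<close>
  cover \<open>K\<close>. Finitely many suffice, and the maximum of their bounds works for all of
  \<open>K\<close>.\<close>

lemma compact_extension_bound:
  assumes "compactin (powertop_real T) K" "K \<subseteq> tits_cone T m"
  obtains c where "\<And>f. f \<in> extensional S \<Longrightarrow> restrict f T \<in> K \<Longrightarrow> \<forall>s\<in>S - T. c < f s \<Longrightarrow>
    f \<in> tits_cone S m \<and> positive_off f"
proof -
  define B where "B p = PiE T (\<lambda>t. {p t<..})" for p :: "'a \<Rightarrow> real"
  have opO: "openin (powertop_real T) (B p)" for p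
    unfolding B_def openin_PiE[OF T.fin] using open_greaterThan open_openin by blast
  have "K \<subseteq> \<Union> (B ` tits_union T m)"
  proof
    fix y assume "y \<in> K"
    then have "y \<in> tits_cone T m" using assms(2) by blast
    then obtain \<epsilon> where y: "y \<in> extensional T" and \<epsilon>: "\<epsilon> > 0"
      "\<And>g. g \<in> extensional T \<Longrightarrow> \<forall>t\<in>T. \<bar>g t - y t\<bar> < \<epsilon> \<Longrightarrow> g \<in> tits_union T m"
      unfolding T_tits_cone_iff by blast
    \<comment> \<open>Half of \<epsilon> keeps \<open>p\<close> in the Tits union while
      \<open>y\<close> is strictly above \<open>p\<close> in every coordinate.\<close>
    define p where "p = (\<lambda>t\<in>T. y t - \<epsilon> / 2)"
    have "p \<in> tits_union T m" using \<epsilon>(1) by (intro \<epsilon>(2)) (auto simp: p_def)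
    moreover have "y \<in> B p" using y \<epsilon>(1) by (auto simp: B_def p_def PiE_iff)
    ultimately show "y \<in> \<Union> (B ` tits_union T m)" by blast
  qed
  then obtain \<F> where \<F>: "finite \<F>" "\<F> \<subseteq> B ` tits_union T m" "K \<subseteq> \<Union>\<F>"
    using assms(1) opO unfolding compactin_def by (metis (no_types, lifting) imageE)
  then obtain P where P: "P \<subseteq> tits_union T m" "finite P" "\<F> = B ` P"
    using finite_subset_image by metis
  obtain b where b: "\<And>p f. p \<in> P \<Longrightarrow> \<forall>t\<in>T. p t \<le> f t \<Longrightarrow> \<forall>s\<in>S - T. b p < f s \<Longrightarrow> positive_off f"
  proof -
    have "\<exists>c. \<forall>f. (\<forall>t\<in>T. p t \<le> f t) \<longrightarrow> (\<forall>s\<in>S - T. c < f s) \<longrightarrow> positive_off f" if "p \<in> P" for p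
      using ex_positive_off_bound[of p] P(1) that by blast
    then obtain b where "\<forall>p\<in>P. \<forall>f. (\<forall>t\<in>T. p t \<le> f t) \<longrightarrow> (\<forall>s\<in>S - T. b p < f s) \<longrightarrow> positive_off f"
      by metis
    then show ?thesis using that by blast
  qed
  \<comment> \<open>The inserted 0 covers the case of an empty cover.\<close>
  define c where "c = Max (insert 0 (b ` P))"
  have bc: "b p \<le> c" if "p \<in> P" for p using P(2) that by (simp add: c_def)
  have "f \<in> tits_cone S m \<and> positive_off f"
    if f: "f \<in> extensional S" "restrict f T \<in> K" "\<forall>s\<in>S - T. c < f s" for f
  proof
    obtain p where p: "p \<in> P" "restrict f T \<in> B p" using f(2) \<F>(3) P(3) by blast
    have pf: "p t < f t" if "t \<in> T" for t
      using PiE_mem[OF p(2)[unfolded B_def] that] that by simp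
    have bf: "b p < f s" if "s \<in> S - T" for s
      using f(3) bc[OF p(1)] that by force
    show "positive_off f" using b[OF p(1), of f] pf bf by (meson less_imp_le)
    have "restrict f T \<in> tits_cone T m" using f(2) assms(2) by blast
    then obtain \<epsilon> where \<epsilon>: "\<epsilon> > 0"
      "\<And>g. g \<in> extensional T \<Longrightarrow> \<forall>t\<in>T. \<bar>g t - restrict f T t\<bar> < \<epsilon> \<Longrightarrow> g \<in> tits_union T m"
      unfolding T_tits_cone_iff by blast
    \<comment> \<open>\<open>d\<close> collects the slack in the strict inequalities satisfied by
      \<open>f\<close>. They survive a perturbation smaller than its minimum, so a whole
      neighbourhood of \<open>f\<close> lies in the Tits union.\<close>
    define d where "d s = (if s \<in> T then f s - p s else f s - b p)" for s
    have "\<forall>s\<in>S. 0 < d s" using pf bf by (simp add: d_def)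
    from ex_positive_lower_bound[OF fin this]
    obtain \<eta> where \<eta>: "0 < \<eta>" "\<And>s. s \<in> S \<Longrightarrow> \<eta> \<le> d s" by blast
    define \<mu> where "\<mu> = min \<epsilon> \<eta>"
    have \<mu>: "0 < \<mu>" "\<mu> \<le> \<epsilon>" "\<mu> \<le> \<eta>" using \<epsilon>(1) \<eta>(1) by (simp_all add: \<mu>_def)
    have "g \<in> tits_union S m" if g: "g \<in> extensional S" "\<forall>s\<in>S. \<bar>g s - f s\<bar> < \<mu>" for g
    proof (rule tits_union_extension[OF g(1)])
      have near: "\<bar>g s - f s\<bar> < \<epsilon>" "\<bar>g s - f s\<bar> < \<eta>" if "s \<in> S" for s
        using g(2) that \<mu>(2,3) by force+
      have "\<forall>t\<in>T. \<bar>restrict g T t - restrict f T t\<bar> < \<epsilon>"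
        using near(1) TS by (simp add: subset_iff)
      then show "restrict g T \<in> tits_union T m"
        by (rule \<epsilon>(2)[OF restrict_extensional])
      have "p t \<le> g t" if t: "t \<in> T" for t
      proof -
        have "\<eta> \<le> f t - p t" using \<eta>(2)[of t] t TS by (auto simp: d_def)
        moreover have "\<bar>g t - f t\<bar> < \<eta>" using near(2) t TS by blast
        ultimately show ?thesis by linarith
      qed
      moreover have "b p < g s" if s: "s \<in> S - T" for s
      proof -
        have "\<eta> \<le> f s - b p" using \<eta>(2)[of s] s by (simp add: d_def)
        moreover have "\<bar>g s - f s\<bar> < \<eta>" using near(2) s by blast
        ultimately show ?thesis by linarith
      qed
      ultimately show "positive_off g" using b[OF p(1), of g] by blast
    qed
    then show "f \<in> tits_cone S m"
      unfolding tits_cone_iff using f(1) \<mu>(1) by blast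
  qed
  then show ?thesis using that by blast
qed

text \<open>Writing the group element as \<open>u v\<close>, the root \<open>v e\<^sub>s\<close> is a nonnegative combination of the \<open>e\<^sub>t\<close>
  with \<open>t \<in> T\<close>; applying \<open>v\<inverse>\<close> exhibits \<open>e\<^sub>s\<close> as a combination of nonnegative vectors, all of which must then
  be multiples of \<open>e\<^sub>s\<close>.\<close>

lemma root_supported:
  assumes ws: "ws \<in> lists S" and s: "s \<in> S" and supp: "\<forall>r. r \<notin> T \<longrightarrow> act ws (cvec s) r = 0"
  obtains u t c where "u \<in> lists T" "t \<in> T" "act u (cvec t) = (\<lambda>r. c * act ws (cvec s) r)"
proof -
  obtain u v where uv: "u \<in> lists T" "v \<in> lists S" "act ws = act (u @ v)"
    "\<And>t r. t \<in> T \<Longrightarrow> 0 \<le> act (rev v) (cvec t) r"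
    using coset_decomposition[OF ws TS] by blast
  define \<delta> where "\<delta> = act v (cvec s)"
  have ru: "rev u \<in> lists T" using uv(1) by simp
  have \<delta>_eq: "\<delta> = act (rev u) (act ws (cvec s))"
    by (simp add: uv(3) \<delta>_def act_rev[OF lists_TS[OF uv(1)]])
  have \<delta>_out: "\<forall>r. r \<notin> T \<longrightarrow> \<delta> r = 0"
    unfolding \<delta>_eq by (rule refl_word_outside[OF ru supp])
  have "cvec s = act (rev v) \<delta>" by (simp add: \<delta>_def act_rev[OF uv(2)])
  then have exp: "cvec s r = (\<Sum>t\<in>T. \<delta> t * act (rev v) (cvec t) r)" for r
    using refl_word_expansion[OF T.fin \<delta>_out] by metis
  \<comment> \<open>A nonpositive \<delta> would make the coordinate of e_s at \<open>s\<close>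
    nonpositive, since the vectors v^-1 e_t are nonnegative.\<close>
  have "\<not> (\<forall>r. \<delta> r \<le> 0)"
  proof
    assume "\<forall>r. \<delta> r \<le> 0"
    then have "(\<Sum>t\<in>T. \<delta> t * act (rev v) (cvec t) s) \<le> 0"
      using uv(4) by (intro sum_nonpos mult_nonpos_nonneg) auto
    then show False unfolding exp[symmetric] by (simp add: cvec_def)
  qed
  then have \<delta>_nonneg: "0 \<le> \<delta> r" for r
    using root_sign[OF uv(2) s] unfolding \<delta>_def by blast
  have "\<exists>t\<in>T. \<delta> t \<noteq> 0"
  proof (rule ccontr)
    assume "\<not> (\<exists>t\<in>T. \<delta> t \<noteq> 0)"
    then have "cvec s s = 0" unfolding exp by simp
    then show False by (simp add: cvec_def)
  qed
  then obtain t where t: "t \<in> T" "\<delta> t \<noteq> 0" by blast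
  have "act (rev v) (cvec t) r = 0" if "r \<noteq> s" for r
  proof -
    have "(\<Sum>t\<in>T. \<delta> t * act (rev v) (cvec t) r) = 0"
      unfolding exp[symmetric] using that by (simp add: cvec_def)
    then have "\<delta> t * act (rev v) (cvec t) r = 0"
      using sum_nonneg_eq_0_iff[OF T.fin, of "\<lambda>t. \<delta> t * act (rev v) (cvec t) r"]
        \<delta>_nonneg uv(4) t(1) by auto
    then show ?thesis using t(2) by simp
  qed
  then have "act (rev v) (cvec t) = (\<lambda>r. act (rev v) (cvec t) s * cvec s r)"
    by (auto simp: cvec_def)
  then obtain c where c: "act (rev v) (cvec t) = (\<lambda>r. c * cvec s r)" by blast
  have "cvec t = act v (act (rev v) (cvec t))" by (simp add: act_rev'[OF uv(2)])
  also have "\<dots> = (\<lambda>r. c * \<delta> r)" unfolding c refl_word_scale \<delta>_def ..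
  finally have "act u (cvec t) = act u (\<lambda>r. c * \<delta> r)" by simp
  also have "\<dots> = (\<lambda>r. c * act ws (cvec s) r)"
    unfolding refl_word_scale by (simp add: \<delta>_def uv(3))
  finally show ?thesis using that uv(1) t(1) by blast
qed

text \<open>If a root supported in \<open>T\<close> annihilates both functionals, so does a multiple
  of it that is a root of \<open>T\<close>, against the assumption on the restrictions. On any other
  root \<open>f\<close> is nonzero.\<close>

lemma complement_points_extension:
  assumes f: "f \<in> tits_cone S m" "positive_off f" and g: "g \<in> extensional S"
    and T: "(restrict f T, restrict g T) \<in> complement_points T m"
  shows "(f, g) \<in> complement_points S m"
proof -
  have "\<not> (pairing S f (act ws (cvec s)) = 0 \<and> pairing S g (act ws (cvec s)) = 0)"
    if ws: "ws \<in> lists S" and s: "s \<in> S" for ws s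
  proof (cases "\<forall>r. r \<notin> T \<longrightarrow> act ws (cvec s) r = 0")
    case True
    obtain u t c where u: "u \<in> lists T" "t \<in> T" "act u (cvec t) = (\<lambda>r. c * act ws (cvec s) r)"
      using root_supported[OF ws s True] by blast
    have "pairing T (restrict h T) (T.act u (cvec t)) = c * pairing S h (act ws (cvec s))" for h
      unfolding T_pairing[OF u(1,2)] u(3) pairing_scale ..
    moreover have "\<not> (pairing T (restrict f T) (T.act u (cvec t)) = 0 \<and>
        pairing T (restrict g T) (T.act u (cvec t)) = 0)"
      using T u(1,2) unfolding complement_points_def by blast
    ultimately show ?thesis by auto
  next
    case False
    \<comment> \<open>Appending \<open>s\<close> realizes the negative of the root by a word, so
      \<open>positive_off\<close> applies to whichever of the two is nonnegative.\<close>
    have neg: "act (ws @ [s]) (cvec s) = (\<lambda>r. - act ws (cvec s) r)"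
      using s by (simp add: refl_op_self act_neg)
    have "ws @ [s] \<in> lists S" using ws s by simp
    moreover obtain r where r: "r \<notin> T" "act ws (cvec s) r \<noteq> 0" using False by blast
    moreover have "act (ws @ [s]) (cvec s) r \<noteq> 0" unfolding neg using r(2) by simp
    moreover have "(\<forall>u. 0 \<le> act ws (cvec s) u) \<or> (\<forall>u. 0 \<le> act (ws @ [s]) (cvec s) u)"
      unfolding neg using root_sign[OF ws s] by simp
    ultimately have "0 < pairing S f (act ws (cvec s)) \<or> 0 < pairing S f (act (ws @ [s]) (cvec s))"
      using f(2) ws s unfolding positive_off_def by blast
    moreover have "pairing S f (act (ws @ [s]) (cvec s)) = - pairing S f (act ws (cvec s))"
      unfolding neg by (simp add: pairing_def sum_negf)
    ultimately show ?thesis by linarith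
  qed
  then show ?thesis unfolding complement_points_def using f(1) g by simp
qed

end

section \<open>Asphericity and sections over compact sets\<close>

text \<open>The sphere is a closed subset of a product of intervals [-1, 1], which is compact by
  Tychonoff's theorem.\<close>

lemma compact_space_nsphere: "compact_space (nsphere n)"
proof -
  let ?C = "{x :: nat \<Rightarrow> real. (\<Sum>i\<le>n. (x i)\<^sup>2) = 1 \<and> (\<forall>i>n. x i = 0)}"
  have "compactin (powertop_real UNIV) (PiE UNIV (\<lambda>i :: nat. {-1..1}))"
    by (simp add: compactin_PiE compactin_euclidean_iff)
  moreover have "?C \<subseteq> PiE UNIV (\<lambda>i :: nat. {-1..1})"
  proof
    fix x assume x: "x \<in> ?C"
    have "\<bar>x i\<bar> \<le> 1" for i
    proof (cases "i \<le> n")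
      case True
      then have "(x i)\<^sup>2 \<le> (\<Sum>i\<le>n. (x i)\<^sup>2)"
        by (intro member_le_sum) auto
      then show ?thesis using x by (simp add: abs_square_le_1)
    qed (use x in auto)
    then show "x \<in> PiE UNIV (\<lambda>i :: nat. {-1..1})" by (auto simp: PiE_UNIV_domain abs_le_iff minus_le_iff)
  qed
  moreover have "closed ?C"
  proof -
    have "?C = {x. (\<Sum>i\<le>n. (x i)\<^sup>2) = 1} \<inter> (\<Inter>i\<in>{n<..}. {x. x i = 0})" by auto
    moreover have "closed {x :: nat \<Rightarrow> real. (\<Sum>i\<le>n. (x i)\<^sup>2) = 1}"
      by (intro closed_Collect_eq continuous_intros continuous_on_product_coordinates)
    moreover have "closed {x :: nat \<Rightarrow> real. x i = 0}" for i
      by (intro closed_Collect_eq continuous_intros continuous_on_product_coordinates)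
    ultimately show ?thesis by (simp only:) (intro closed_Int closed_INT ballI)
  qed
  then have "closedin (powertop_real UNIV) ?C"
    by (simp add: euclidean_product_topology)
  ultimately have "compactin (powertop_real UNIV) ?C"
    by (rule closed_compactin)
  then show ?thesis by (simp add: nsphere compact_space_subtopology)
qed

lemma sphere_base_in_nsphere: "sphere_base \<in> topspace (nsphere n)"
  unfolding sphere_base_def by (rule in_topspace_nsphere)

text \<open>The constant map is itself pointed, so a unique class can only be the class of the
  constant map.\<close>

lemma homotopy_classes_is_singleton_iff:
  assumes "a \<in> topspace X"
  shows "is_singleton (homotopy_classes n X a) \<longleftrightarrow>
    (\<forall>f\<in>pointed_maps n X a. homotopic_with (\<lambda>h. h sphere_base = a) (nsphere n) X f (\<lambda>x. a))"
    (is "?L \<longleftrightarrow> ?R")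
proof -
  define E where "E = {(f, g). homotopic_with (\<lambda>h. h sphere_base = a) (nsphere n) X f g}"
  have hc: "homotopy_classes n X a = (\<lambda>f. E `` {f}) ` pointed_maps n X a"
    by (auto simp: homotopy_classes_def quotient_def E_def)
  have const: "(\<lambda>x. a) \<in> pointed_maps n X a"
    using assms by (simp add: pointed_maps_def)
  show ?thesis
  proof
    assume ?L
    then obtain C where C: "homotopy_classes n X a = {C}" by (rule is_singletonE)
    show ?R
    proof
      fix f assume f: "f \<in> pointed_maps n X a"
      have "E `` {f} \<in> {C}" "E `` {\<lambda>x. a} \<in> {C}"
        using f const unfolding C[symmetric] hc by (auto intro!: imageI)
      then have "E `` {f} = E `` {\<lambda>x. a}" by simp
      moreover have "(\<lambda>x. a) \<in> E `` {\<lambda>x. a}"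
        using const by (simp add: E_def pointed_maps_def)
      ultimately have "(\<lambda>x. a) \<in> E `` {f}" by simp
      then show "homotopic_with (\<lambda>h. h sphere_base = a) (nsphere n) X f (\<lambda>x. a)"
        by (simp add: E_def)
    qed
  next
    assume R: ?R
    have "E `` {f} = E `` {\<lambda>x. a}" if "f \<in> pointed_maps n X a" for f
    proof -
      have "homotopic_with (\<lambda>h. h sphere_base = a) (nsphere n) X f (\<lambda>x. a)" using R that by blast
      then show ?thesis
        by (auto simp: E_def intro: homotopic_with_trans homotopic_with_trans[OF homotopic_with_symD])
    qed
    then have "homotopy_classes n X a = {E `` {\<lambda>x. a}}"
      unfolding hc using const by blast
    then show ?L by simp
  qed
qed

text \<open>Sections over compact sets suffice: for path connectedness the two end points form a
  compact set, and for homotopy groups the image of a sphere is compact.\<close>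

lemma aspherical_if_compact_sections:
  assumes X: "aspherical X" and p: "continuous_map X Y p"
    and sec: "\<And>K. compactin Y K \<Longrightarrow>
      \<exists>j. continuous_map (subtopology Y K) X j \<and> (\<forall>y\<in>K. p (j y) = y)"
  shows "aspherical Y"
  unfolding aspherical_def
proof (intro conjI allI impI ballI)
  show "topspace Y \<noteq> {}"
    using X continuous_map_image_subset_topspace[OF p] by (auto simp: aspherical_def)
  show "path_connected_space Y"
    unfolding path_connected_space_def
  proof (intro ballI)
    fix a b assume ab: "a \<in> topspace Y" "b \<in> topspace Y"
    then have "compactin Y {a, b}" by (intro finite_imp_compactin) auto
    then obtain j where j: "continuous_map (subtopology Y {a, b}) X j" "p (j a) = a" "p (j b) = b"
      using sec by (metis insertCI)
    have "j a \<in> topspace X" "j b \<in> topspace X"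
      using continuous_map_image_subset_topspace[OF j(1)] ab by auto
    then obtain g where g: "pathin X g" "g 0 = j a" "g 1 = j b"
      using X unfolding aspherical_def path_connected_space_def by blast
    then have "pathin Y (p \<circ> g)" using p pathin_compose by blast
    then show "\<exists>g. pathin Y g \<and> g 0 = a \<and> g 1 = b"
      using g j by (metis comp_apply)
  qed
  fix n :: nat and a assume n: "2 \<le> n" and a: "a \<in> topspace Y"
  have "homotopic_with (\<lambda>h. h sphere_base = a) (nsphere n) Y f (\<lambda>x. a)"
    if f: "f \<in> pointed_maps n Y a" for f
  proof -
    have cf: "continuous_map (nsphere n) Y f" and fa: "f sphere_base = a"
      using f by (simp_all add: pointed_maps_def)
    define K where "K = f ` topspace (nsphere n)"
    have "compactin Y K"
      unfolding K_def using compact_space_nsphere cf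
      by (metis compact_space_def image_compactin)
    then obtain j where cj: "continuous_map (subtopology Y K) X j" and pj: "\<And>y. y \<in> K \<Longrightarrow> p (j y) = y"
      using sec by blast
    have cfK: "continuous_map (nsphere n) (subtopology Y K) f"
      using cf by (simp add: continuous_map_in_subtopology K_def)
    have aK: "a \<in> K" using fa sphere_base_in_nsphere K_def by blast
    have ja: "j a \<in> topspace X"
      using continuous_map_image_subset_topspace[OF cj] a aK by auto
    have "j \<circ> f \<in> pointed_maps n X (j a)"
      using continuous_map_compose[OF cfK cj] fa by (simp add: pointed_maps_def)
    moreover have "is_singleton (homotopy_classes n X (j a))"
      using X n ja unfolding aspherical_def by blast
    ultimately have "homotopic_with (\<lambda>h. h sphere_base = j a) (nsphere n) X (j \<circ> f) (\<lambda>x. j a)"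
      using homotopy_classes_is_singleton_iff[OF ja] by blast
    \<comment> \<open>The projected contraction fixes the base point because
      \<open>p (j a) = a\<close>.\<close>
    then have 1: "homotopic_with (\<lambda>h. h sphere_base = a) (nsphere n) Y (p \<circ> (j \<circ> f)) (p \<circ> (\<lambda>x. j a))"
      by (rule homotopic_with_compose_continuous_map_left[OF _ p]) (simp add: pj aK)
    have 2: "homotopic_with (\<lambda>h. h sphere_base = a) (nsphere n) Y f (p \<circ> (j \<circ> f))"
      using cf fa pj aK by (intro homotopic_with_equal) (auto simp: K_def)
    have "p \<circ> (\<lambda>x :: nat \<Rightarrow> real. j a) = (\<lambda>x. a)" using pj[OF aK] by (simp add: comp_def)
    then show ?thesis using homotopic_with_trans[OF 2 1] by (simp only:)
  qed
  then show "is_singleton (homotopy_classes n Y a)"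
    using homotopy_classes_is_singleton_iff[OF a] by blast
qed

section \<open>The restriction map between the two complements and its sections\<close>

context parabolic
begin

lemma continuous_restrict:
  "continuous_map (powertop_real S) (powertop_real T) (\<lambda>f. restrict f T)"
  using TS by (intro continuous_map_componentwise[THEN iffD2] conjI ballI)
    (auto intro!: continuous_map_product_projection)

lemma continuous_extend:
  "continuous_map (powertop_real T) (powertop_real S) (\<lambda>f. \<lambda>s\<in>S. if s \<in> T then f s else c)"
proof -
  have "continuous_map (powertop_real T) euclideanreal (\<lambda>f. (\<lambda>s\<in>S. if s \<in> T then f s else c) s)"
    if "s \<in> S" for s
    using that by (cases "s \<in> T") (auto intro!: continuous_map_product_projection)
  then show ?thesis by (auto simp: continuous_map_componentwise)
qed

lemma restrict_extend: "f \<in> extensional T \<Longrightarrow> restrict (\<lambda>s\<in>S. if s \<in> T then f s else c) T = f"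
  using TS by (auto simp: extensional_def restrict_def fun_eq_iff)

lemma continuous_restrict_complement:
  "continuous_map (arrangement_complement S m) (arrangement_complement T m)
    (\<lambda>(f, g). (restrict f T, restrict g T))"
  unfolding arrangement_complement_eq T.arrangement_complement_eq
proof (rule continuous_map_into_subtopology)
  show "continuous_map (subtopology (prod_topology (powertop_real S) (powertop_real S)) (complement_points S m))
      (prod_topology (powertop_real T) (powertop_real T)) (\<lambda>(f, g). (restrict f T, restrict g T))"
    by (intro continuous_map_from_subtopology continuous_map_prod_top[THEN iffD2] disjI2 conjI
        continuous_restrict)
qed (use restrict_complement_points in auto)

lemma compact_section:
  assumes "compactin (arrangement_complement T m) K"
  shows "\<exists>j. continuous_map (subtopology (arrangement_complement T m) K) (arrangement_complement S m) j \<and>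
    (\<forall>y\<in>K. (\<lambda>(f, g). (restrict f T, restrict g T)) (j y) = y)"
proof -
  have KT: "K \<subseteq> complement_points T m"
    and cK: "compactin (prod_topology (powertop_real T) (powertop_real T)) K"
    using assms by (simp_all add: T.arrangement_complement_eq compactin_subtopology)
  have "compactin (powertop_real T) (fst ` K)"
    using image_compactin[OF cK continuous_map_fst] .
  moreover have "fst ` K \<subseteq> tits_cone T m"
    using KT by (auto simp: complement_points_def)
  ultimately obtain c where c: "\<And>f. f \<in> extensional S \<Longrightarrow> restrict f T \<in> fst ` K \<Longrightarrow>
      \<forall>s\<in>S - T. c < f s \<Longrightarrow> f \<in> tits_cone S m \<and> positive_off f"
    using compact_extension_bound by blast
  \<comment> \<open>The value \<open>c + 1\<close> meets the strict bound outside \<open>T\<close>.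
    For the second functional any continuous extension would do, and the same formula is
    used.\<close>
  define e where "e f = (\<lambda>s\<in>S. if s \<in> T then f s else c + 1)" for f
  define j where "j = (\<lambda>(f, g). (e f, e g))"
  have ext: "f \<in> extensional T" "g \<in> extensional T" if "(f, g) \<in> K" for f g
    using compactin_subset_topspace[OF cK] that by (auto simp: topspace_powertop_real simp del: topspace_product_topology)
  have re: "restrict (e f) T = f" if "f \<in> extensional T" for f
    unfolding e_def by (rule restrict_extend[OF that])
  have sect: "(\<lambda>(f, g). (restrict f T, restrict g T)) (j y) = y" if "y \<in> K" for y
    using that ext by (cases y) (simp add: j_def re)
  have jK: "j y \<in> complement_points S m" if "y \<in> K" for y
  proof -
    obtain f g where y: "y = (f, g)" by force
    have r: "restrict (e f) T = f" "restrict (e g) T = g"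
      using that ext unfolding y by (simp_all add: re)
    have "e f \<in> tits_cone S m \<and> positive_off (e f)"
    proof (rule c)
      show "restrict (e f) T \<in> fst ` K" using that r(1) by (force simp: y)
    qed (simp_all add: e_def)
    then have "(e f, e g) \<in> complement_points S m"
      using KT that r by (intro complement_points_extension) (auto simp: y e_def)
    then show ?thesis by (simp add: j_def y)
  qed
  have "continuous_map (subtopology (arrangement_complement T m) K) (arrangement_complement S m) j"
    unfolding arrangement_complement_eq T.arrangement_complement_eq subtopology_subtopology
  proof (rule continuous_map_into_subtopology)
    show "continuous_map (subtopology (prod_topology (powertop_real T) (powertop_real T)) (complement_points T m \<inter> K))
        (prod_topology (powertop_real S) (powertop_real S)) j"
      unfolding j_def e_def
      by (intro continuous_map_from_subtopology continuous_map_prod_top[THEN iffD2] disjI2 conjI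
        continuous_extend)
  qed (use jK in auto)
  then show ?thesis using sect by blast
qed

end

theorem corollary2p4:
  fixes S T :: "'a set" and m :: "'a \<Rightarrow> 'a \<Rightarrow> enat"
  assumes "coxeter_matrix S m"
    and "T \<subseteq> S"
    and "type_K_pi_1 S m"
  shows "type_K_pi_1 T m"
proof -
  interpret parabolic S m T
    using assms(1,2) by unfold_locales
  show ?thesis
    using assms(3) continuous_restrict_complement compact_section
    unfolding type_K_pi_1_def by (rule aspherical_if_compact_sections)
qed

end
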